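(* Let $\Psi_{b_*}(t)$ be the nearly Kähler half corresponding to the inhomogeneous nearly Kähler structure on $S^3\times S^3$ of Foscolo and Haskins, with maximal volume orbit at time $T_*$, and let $w_1,w_2$ be its associated functions. Then (i) $w_1(t)>0$ for $t\in(0,T_* )$, and (ii) $w_2(T_* )>0$.
   Context: For $p,q\in\mathbb R^3$ (indices $0,1,2$) put $\langle p,q\rangle=-p_0q_0+p_1q_1+p_2q_2$, $|p|^2=\langle p,p\rangle$. A (local) cohomogeneity one nearly Kähler structure (with principal orbit $N_{1,1}=\mathrm{SU}(2)\times\mathrm{SU}(2)/\Delta\mathrm U(1)\cong S^2\times S^3$) is given by smooth functions $\Psi(t)=(\lambda,u,v)$, $u=(u_0,u_1,u_2)$, $v=(v_0,v_1,v_2)$ on an interval with $\lambda>0$, $|u|^2>0$, $u_2<0$, $u_1v_2-u_2v_1>0$, satisfying $$\lambda u_0'+3v_0=0,\quad \lambda u_1'+3v_1=2\lambda^2,\quad \lambda u_2'+3v_2=0,\quad v_0'=4\lambda u_0,\quad v_1'=4\lambda u_1,\quad v_2'=4\lambda u_2-3\tfrac{u_2}{\lambda},$$ $$\langle u,v\rangle=0,\quad \lambda^2|u|^2=u_2^2,\quad \lambda^2|u|^2=|v|^2,\quad v_1=|u|^2.$$ Put $\mu=|u|$ and $w=(w_0,w_1,w_2)=\frac1{\lambda\mu^2}(u_1v_2-v_1u_2,\ u_0v_2-u_2v_0,\ u_1v_0-v_1u_0)$. For $b>0$, $\Psi_b$ denotes the unique solution of this system for $t>0$ that extends smoothly over a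 singular orbit $\mathrm{SU}(2)^2/\Delta\mathrm{SU}(2)\cong S^3$ at $t=0$ with $\lambda(0)=b$; it has $\lambda=b+O(t^2)$, $u=(2b^2t,\,2bt,\,-2b^2t)+O(t^3)$, $v=(-\frac23b^3,0,\frac23b^3)+O(t^2)$, and depends continuously on $b$. It has a unique maximal volume orbit, at the unique time $T_b>0$ with $\partial_t(\lambda\mu^2)=0$. Write $w^b$ for the function $w$ of $\Psi_b$. The value $b=1$ gives the homogeneous nearly Kähler structure on $S^3\times S^3$, with $T_1=\frac{\pi\sqrt3}{6}$, $w^1_1>0$ on $(0,T_1]$. Foscolo–Haskins show that $w^b_1(T_b)=0$ for some $b\in(0,1)$; $b_*$ denotes the last such value before $b=1$, i.e. the largest $b\in(0,1)$ with $w_1^b(T_b)=0$, and $T_*=T_{b_*}$. A known fact (Foscolo–Haskins): if $w_1=w_2=0$ at some time then the structure is the sine-cone over the homogeneous Sasaki–Einstein structure, which is none of the $\Psi_b$. *)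

theory Defs
  imports "HOL-Analysis.Analysis" "HOL-Library.Landau_Symbols"
begin

(* Vectors in R^3 are of type real^3 with components p $ 0, p $ 1, p $ 2; in the index type 3 the
   numerals are read modulo 3, so 0, 1, 2 are its three distinct elements (and 3 = 0). *)

definition mink :: "real^3 \<Rightarrow> real^3 \<Rightarrow> real" where
  "mink p q = - p $ 0 * q $ 0 + p $ 1 * q $ 1 + p $ 2 * q $ 2"

(* To be applied to open S only: deriv is a two-sided derivative. *)
definition smooth_real_on :: "real set \<Rightarrow> (real \<Rightarrow> real) \<Rightarrow> bool" where
  "smooth_real_on S f \<longleftrightarrow> (\<forall>n. \<forall>t\<in>S. ((deriv ^^ n) f) differentiable (at t))"

definition smooth_triple_on ::
  "real set \<Rightarrow> (real \<Rightarrow> real) \<Rightarrow> (real \<Rightarrow> real^3) \<Rightarrow> (real \<Rightarrow> real^3) \<Rightarrow> bool" where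
  "smooth_triple_on S lam u v \<longleftrightarrow>
     smooth_real_on S lam \<and>
     (\<forall>i. smooth_real_on S (\<lambda>t. u t $ i)) \<and>
     (\<forall>i. smooth_real_on S (\<lambda>t. v t $ i))"

definition nk_structure_on ::
  "real set \<Rightarrow> (real \<Rightarrow> real) \<Rightarrow> (real \<Rightarrow> real^3) \<Rightarrow> (real \<Rightarrow> real^3) \<Rightarrow> bool" where
  "nk_structure_on S lam u v \<longleftrightarrow>
     smooth_triple_on S lam u v \<and>
     (\<forall>t\<in>S.
        lam t > 0 \<and> mink (u t) (u t) > 0 \<and> u t $ 2 < 0 \<and>
        u t $ 1 * v t $ 2 - u t $ 2 * v t $ 1 > 0 \<and>
        lam t * deriv (\<lambda>s. u s $ 0) t + 3 * v t $ 0 = 0 \<and>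
        lam t * deriv (\<lambda>s. u s $ 1) t + 3 * v t $ 1 = 2 * (lam t)\<^sup>2 \<and>
        lam t * deriv (\<lambda>s. u s $ 2) t + 3 * v t $ 2 = 0 \<and>
        deriv (\<lambda>s. v s $ 0) t = 4 * lam t * u t $ 0 \<and>
        deriv (\<lambda>s. v s $ 1) t = 4 * lam t * u t $ 1 \<and>
        deriv (\<lambda>s. v s $ 2) t = 4 * lam t * u t $ 2 - 3 * (u t $ 2 / lam t) \<and>
        mink (u t) (v t) = 0 \<and>
        (lam t)\<^sup>2 * mink (u t) (u t) = (u t $ 2)\<^sup>2 \<and>
        (lam t)\<^sup>2 * mink (u t) (u t) = mink (v t) (v t) \<and>
        v t $ 1 = mink (u t) (u t))"

definition nk_mu :: "real^3 \<Rightarrow> real" where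
  "nk_mu p = sqrt (mink p p)"

definition nk_w :: "real \<Rightarrow> real^3 \<Rightarrow> real^3 \<Rightarrow> real^3" where
  "nk_w l p q = (1 / (l * (nk_mu p)\<^sup>2)) *\<^sub>R
     (\<chi> i. if i = 0 then p $ 1 * q $ 2 - q $ 1 * p $ 2
          else if i = 1 then p $ 0 * q $ 2 - p $ 2 * q $ 0
          else p $ 1 * q $ 0 - q $ 1 * p $ 0)"

(* A nearly Kaehler structure on (0,R) that closes smoothly over a singular orbit S^3 at t = 0 with
   lam 0 = b.  The functions are taken already extended to (-R,R): smoothness over the orbit means
   that lam, v extend as smooth even functions and u as a smooth odd function.  The leading
   coefficients also fix the sign left free by the symmetry (u0,v0) -> (-u0,-v0) of the system. *)
definition nk_closing_S3 ::
  "real \<Rightarrow> real \<Rightarrow> (real \<Rightarrow> real) \<Rightarrow> (real \<Rightarrow> real^3) \<Rightarrow> (real \<Rightarrow> real^3) \<Rightarrow> bool" where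
  "nk_closing_S3 b R lam u v \<longleftrightarrow>
     R > 0 \<and> nk_structure_on {0<..<R} lam u v \<and>
     smooth_triple_on {-R<..<R} lam u v \<and>
     (\<forall>t\<in>{-R<..<R}. lam (- t) = lam t \<and> u (- t) = - u t \<and> v (- t) = v t) \<and>
     lam 0 = b \<and>
     (\<lambda>t. lam t - b) \<in> O[at_right 0](\<lambda>t. t ^ 2) \<and>
     (\<lambda>t. u t $ 0 - 2 * b\<^sup>2 * t) \<in> O[at_right 0](\<lambda>t. t ^ 3) \<and>
     (\<lambda>t. u t $ 1 - 2 * b * t) \<in> O[at_right 0](\<lambda>t. t ^ 3) \<and>
     (\<lambda>t. u t $ 2 - (- 2 * b\<^sup>2 * t)) \<in> O[at_right 0](\<lambda>t. t ^ 3) \<and>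
     (\<lambda>t. v t $ 0 - (- (2 / 3) * b ^ 3)) \<in> O[at_right 0](\<lambda>t. t ^ 2) \<and>
     (\<lambda>t. v t $ 1) \<in> O[at_right 0](\<lambda>t. t ^ 2) \<and>
     (\<lambda>t. v t $ 2 - (2 / 3) * b ^ 3) \<in> O[at_right 0](\<lambda>t. t ^ 2)"

(* Uniqueness of germs: any other solution of the same singular initial value problem, on an interval
   of any length, agrees where both are defined.  R need not be maximal. *)
definition is_Psi ::
  "real \<Rightarrow> real \<Rightarrow> (real \<Rightarrow> real) \<Rightarrow> (real \<Rightarrow> real^3) \<Rightarrow> (real \<Rightarrow> real^3) \<Rightarrow> bool" where
  "is_Psi b R lam u v \<longleftrightarrow>
     nk_closing_S3 b R lam u v \<and>
     (\<forall>R' lam' u' v'. nk_closing_S3 b R' lam' u' v' \<longrightarrow>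
        (\<forall>t\<in>{0<..<min R R'}. lam' t = lam t \<and> u' t = u t \<and> v' t = v t))"

(* Up to a constant factor, lam * mu^2 is the volume of the principal orbit at time t. *)
definition is_max_volume_time ::
  "real \<Rightarrow> (real \<Rightarrow> real) \<Rightarrow> (real \<Rightarrow> real^3) \<Rightarrow> real \<Rightarrow> bool" where
  "is_max_volume_time R lam u T \<longleftrightarrow>
     T \<in> {0<..<R} \<and>
     (\<forall>t\<in>{0<..<R}. deriv (\<lambda>s. lam s * (nk_mu (u s))\<^sup>2) t = 0 \<longleftrightarrow> t = T)"

end

theory Submission
  imports Defs "HOL-Real_Asymp.Real_Asymp"
begin

text \<open>
  Write \<open>\<mu> = |u|\<close>, so that \<open>v\<^sub>1 = \<mu>\<^sup>2\<close> and \<open>u\<^sub>2 = - \<lambda>\<mu>\<close>. The two functions \<open>Y = \<mu> w\<^sub>1\<close> and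
  \<open>Z = \<lambda> \<mu> w\<^sub>2\<close> satisfy the linear system \<open>Y' = - (3\<mu>/\<lambda>\<^sup>3) Z\<close>, \<open>Z' = (2\<lambda>\<^sup>3/\<mu>) Y\<close>
  (lemmas \<open>shape_one_deriv\<close> and \<open>shape_two_deriv\<close>), whose coefficients have fixed signs. Near the singular orbit
  \<open>Z < 0\<close>, while \<open>Y\<close> starts from \<open>0\<close>; hence \<open>Y\<close> increases and is positive there.

  Suppose \<open>Y \<ge> 0\<close> before some time at which \<open>Y = 0\<close>. Then \<open>Z\<close> is nondecreasing up to that time, and
  if it were still \<open>\<le> 0\<close> at the end, \<open>Y\<close> would have been nondecreasing throughout, hence positive at the end. So
  \<open>Z > 0\<close> at the zero (\<open>shape_two_pos_at_first_zero\<close>). At the maximal volume time this is the second claim.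
  At an interior time it makes \<open>Y\<close> negative right afterwards. Consequently \<open>Y \<ge> 0\<close> on an
  interval \<open>(0,c)\<close> already forces \<open>Y > 0\<close> there: \<open>w\<^sub>1\<close> can lose its positivity on \<open>(0,T\<^sub>b)\<close> only through
  the endpoint \<open>T\<^sub>b\<close> as \<open>b\<close> varies.

  The first claim is therefore a deformation argument in \<open>b\<close>, from \<open>b = 1\<close> down to \<open>b\<^sub>*\<close>
  (\<open>positivity_propagates\<close>). At \<open>b = 1\<close> the solution is the explicit homogeneous one, with \<open>Y = (2/3) sin\<^sup>2 (\<surd>3 t)\<close>.
  For \<open>b\<^sub>* < b \<le> 1\<close> the endpoint value \<open>w\<^sub>1(T\<^sub>b)\<close> does not vanish, so positivity
  on \<open>(0,T\<^sub>b)\<close> is both an open and a closed condition on \<open>b\<close>, and closedness carries it to \<open>b\<^sub>*\<close>.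

  Two facts make the deformation work. The behaviour near \<open>t = 0\<close> is uniform in \<open>b\<close> (\<open>family_near_start\<close>),
  even though \<open>Y\<close> and \<open>volume_speed\<close> are quotients whose denominators vanish at \<open>t = 0\<close>. And \<open>T\<^sub>b\<close> depends continuously on \<open>b\<close>, because
  every critical point of the orbit volume \<open>\<lambda>\<mu>\<^sup>2\<close> is nondegenerate with negative second derivative. That is a
  polynomial inequality on the constraint variety (\<open>critical_inequality\<close>).
\<close>

section \<open>Evolution of w1, w2 and the orbit volume\<close>

text \<open>On a solution, \<open>shape_one\<close> is \<open>\<mu> w\<^sub>1\<close> and \<open>shape_two\<close> is \<open>\<lambda> \<mu> w\<^sub>2\<close>, with \<open>\<lambda>\<close> and \<open>\<mu>\<close> eliminated through
  \<open>\<mu> = \<surd>v\<^sub>1\<close> and \<open>\<lambda> \<mu> = - u\<^sub>2\<close> (see \<open>nk_w_components\<close>). The factors \<open>\<mu>\<close> and \<open>\<lambda> \<mu>\<close> are integrating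
  factors that remove the diagonal terms of the system for \<open>(w\<^sub>1, w\<^sub>2)\<close>.\<close>
definition shape_one :: "real^3 \<Rightarrow> real^3 \<Rightarrow> real" where
  "shape_one p q = q $ 0 - p $ 0 * q $ 2 / p $ 2"

definition shape_two :: "real^3 \<Rightarrow> real^3 \<Rightarrow> real" where
  "shape_two p q = (p $ 1 * q $ 0 - q $ 1 * p $ 0) / sqrt (q $ 1)"

text \<open>A positive multiple of \<open>(\<lambda>\<mu>\<^sup>2)'\<close> (see \<open>volume_deriv\<close>), scaled so that \<open>\<lambda>\<close> does not occur:
  it can then be differentiated with the equations for \<open>u\<close> and \<open>v\<close> alone.\<close>
definition volume_speed :: "real^3 \<Rightarrow> real^3 \<Rightarrow> real" where
  "volume_speed p q = 3 * q $ 2 - 2 * (p $ 2) ^ 3 * p $ 1 / (q $ 1)\<^sup>2"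

lemma smooth_real_onD:
  assumes "smooth_real_on S f" "t \<in> S"
  shows "(f has_real_derivative deriv f t) (at t)"
  using assms unfolding smooth_real_on_def
  by (metis DERIV_deriv_iff_real_differentiable funpow_0)

lemma nk_structureD:
  assumes "nk_structure_on S lam u v" "t \<in> S"
  shows "lam t > 0" "u t $ 2 < 0" "v t $ 1 > 0" "mink (u t) (u t) = v t $ 1"
    and "- u t $ 0 * v t $ 0 + u t $ 1 * v t $ 1 + u t $ 2 * v t $ 2 = 0"
    and "(lam t)\<^sup>2 * v t $ 1 = (u t $ 2)\<^sup>2"
    and "(u t $ 0)\<^sup>2 = (u t $ 1)\<^sup>2 + (u t $ 2)\<^sup>2 - v t $ 1"
    and "(v t $ 0)\<^sup>2 = (v t $ 1)\<^sup>2 + (v t $ 2)\<^sup>2 - (u t $ 2)\<^sup>2"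
proof -
  have a: "lam t > 0" "u t $ 2 < 0" "mink (u t) (u t) > 0" "v t $ 1 = mink (u t) (u t)"
      "mink (u t) (v t) = 0" "(lam t)\<^sup>2 * mink (u t) (u t) = (u t $ 2)\<^sup>2"
      "(lam t)\<^sup>2 * mink (u t) (u t) = mink (v t) (v t)"
    using assms unfolding nk_structure_on_def by auto
  show "lam t > 0" "u t $ 2 < 0" "v t $ 1 > 0" "mink (u t) (u t) = v t $ 1"
    "(lam t)\<^sup>2 * v t $ 1 = (u t $ 2)\<^sup>2"
    using a by auto
  show "- u t $ 0 * v t $ 0 + u t $ 1 * v t $ 1 + u t $ 2 * v t $ 2 = 0"
    using a(5) unfolding mink_def .
  show "(u t $ 0)\<^sup>2 = (u t $ 1)\<^sup>2 + (u t $ 2)\<^sup>2 - v t $ 1"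
    using a(4) unfolding mink_def by (simp add: power2_eq_square)
  show "(v t $ 0)\<^sup>2 = (v t $ 1)\<^sup>2 + (v t $ 2)\<^sup>2 - (u t $ 2)\<^sup>2"
    using a(6,7) unfolding mink_def by (simp add: power2_eq_square)
qed

lemma nk_structure_derivs:
  assumes "nk_structure_on S lam u v" "t \<in> S"
  shows "((\<lambda>s. u s $ 0) has_real_derivative - 3 * v t $ 0 / lam t) (at t)"
    and "((\<lambda>s. u s $ 1) has_real_derivative 2 * lam t - 3 * v t $ 1 / lam t) (at t)"
    and "((\<lambda>s. u s $ 2) has_real_derivative - 3 * v t $ 2 / lam t) (at t)"
    and "((\<lambda>s. v s $ 0) has_real_derivative 4 * lam t * u t $ 0) (at t)"
    and "((\<lambda>s. v s $ 1) has_real_derivative 4 * lam t * u t $ 1) (at t)"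
    and "((\<lambda>s. v s $ 2) has_real_derivative 4 * lam t * u t $ 2 - 3 * u t $ 2 / lam t) (at t)"
proof -
  have sm: "smooth_real_on S (\<lambda>s. u s $ i)" "smooth_real_on S (\<lambda>s. v s $ i)" for i
    using assms(1) unfolding nk_structure_on_def smooth_triple_on_def by auto
  have l: "lam t > 0" using nk_structureD(1)[OF assms] .
  have e: "lam t * deriv (\<lambda>s. u s $ 0) t + 3 * v t $ 0 = 0"
    "lam t * deriv (\<lambda>s. u s $ 1) t + 3 * v t $ 1 = 2 * (lam t)\<^sup>2"
    "lam t * deriv (\<lambda>s. u s $ 2) t + 3 * v t $ 2 = 0"
    "deriv (\<lambda>s. v s $ 0) t = 4 * lam t * u t $ 0"
    "deriv (\<lambda>s. v s $ 1) t = 4 * lam t * u t $ 1"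
    "deriv (\<lambda>s. v s $ 2) t = 4 * lam t * u t $ 2 - 3 * u t $ 2 / lam t"
    using assms unfolding nk_structure_on_def by auto
  have d: "deriv (\<lambda>s. u s $ 0) t = - 3 * v t $ 0 / lam t"
    "deriv (\<lambda>s. u s $ 1) t = 2 * lam t - 3 * v t $ 1 / lam t"
    "deriv (\<lambda>s. u s $ 2) t = - 3 * v t $ 2 / lam t"
    using e(1-3) l by (auto simp: field_simps power2_eq_square)
  show "((\<lambda>s. u s $ 0) has_real_derivative - 3 * v t $ 0 / lam t) (at t)"
    "((\<lambda>s. u s $ 1) has_real_derivative 2 * lam t - 3 * v t $ 1 / lam t) (at t)"
    "((\<lambda>s. u s $ 2) has_real_derivative - 3 * v t $ 2 / lam t) (at t)"
    "((\<lambda>s. v s $ 0) has_real_derivative 4 * lam t * u t $ 0) (at t)"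
    "((\<lambda>s. v s $ 1) has_real_derivative 4 * lam t * u t $ 1) (at t)"
    "((\<lambda>s. v s $ 2) has_real_derivative 4 * lam t * u t $ 2 - 3 * u t $ 2 / lam t) (at t)"
    using smooth_real_onD[OF sm(1) assms(2)] smooth_real_onD[OF sm(2) assms(2)]
    by (metis d(1), metis d(2), metis d(3), metis e(4), metis e(5), metis e(6))
qed

lemma u2_eq_neg_lam_mu:
  assumes "nk_structure_on S lam u v" "t \<in> S"
  shows "u t $ 2 = - (lam t * sqrt (v t $ 1))"
proof -
  note d = nk_structureD[OF assms]
  have "(- u t $ 2)\<^sup>2 = (lam t * sqrt (v t $ 1))\<^sup>2"
    using d by (simp add: power_mult_distrib)
  then show ?thesis using d by (smt (verit) power2_eq_imp_eq mult_nonneg_nonneg real_sqrt_ge_zero)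
qed

lemma nk_w_components:
  assumes "nk_structure_on S lam u v" "t \<in> S"
  shows "nk_w (lam t) (u t) (v t) $ 1 = shape_one (u t) (v t) / sqrt (v t $ 1)"
    and "nk_w (lam t) (u t) (v t) $ 2 = shape_two (u t) (v t) / (lam t * sqrt (v t $ 1))"
proof -
  note d = nk_structureD[OF assms]
  have mu: "(nk_mu (u t))\<^sup>2 = v t $ 1" using d unfolding nk_mu_def by simp
  have s: "sqrt (v t $ 1) * sqrt (v t $ 1) = v t $ 1" "sqrt (v t $ 1) > 0" using d by auto
  have ne: "(1::3) \<noteq> 0" "(2::3) \<noteq> 0" "(2::3) \<noteq> 1" by simp_all
  have "nk_w (lam t) (u t) (v t) $ 1 = (u t $ 0 * v t $ 2 - u t $ 2 * v t $ 0) / (lam t * v t $ 1)"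
    unfolding nk_w_def mu by (simp add: ne)
  also have "\<dots> = (u t $ 0 * v t $ 2 - u t $ 2 * v t $ 0) / (- (u t $ 2)) / sqrt (v t $ 1)"
    using u2_eq_neg_lam_mu[OF assms] s d by (simp add: mult.assoc)
  also have "(u t $ 0 * v t $ 2 - u t $ 2 * v t $ 0) / (- (u t $ 2)) = shape_one (u t) (v t)"
    unfolding shape_one_def using d(2) by (simp add: field_simps)
  finally show "nk_w (lam t) (u t) (v t) $ 1 = shape_one (u t) (v t) / sqrt (v t $ 1)" .
  show "nk_w (lam t) (u t) (v t) $ 2 = shape_two (u t) (v t) / (lam t * sqrt (v t $ 1))"
    unfolding nk_w_def mu shape_two_def using s d by (simp add: ne field_simps)
qed

text \<open>The quotient rule leaves terms in \<open>u\<^sub>0\<close>, \<open>v\<^sub>0\<close> and \<open>v\<^sub>2\<close>. The constraint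
  \<open>|v|\<^sup>2 = u\<^sub>2\<^sup>2\<close> turns them into a multiple of \<open>\<langle>u,v\<rangle>\<close>, which vanishes, and the numerator of \<open>w\<^sub>2\<close>.\<close>
lemma shape_one_deriv:
  assumes "nk_structure_on S lam u v" "t \<in> S"
  shows "((\<lambda>s. shape_one (u s) (v s)) has_real_derivative
     - (3 * sqrt (v t $ 1) / (lam t)^3) * shape_two (u t) (v t)) (at t)"
proof -
  note d = nk_structureD[OF assms] and D = nk_structure_derivs[OF assms]
  define l u0 u1 u2 v0 v1 v2 where defs: "l = lam t" "u0 = u t $ 0" "u1 = u t $ 1" "u2 = u t $ 2"
    "v0 = v t $ 0" "v1 = v t $ 1" "v2 = v t $ 2"
  note d = d[folded defs] and D = D[folded defs]
  have "((\<lambda>s. shape_one (u s) (v s)) has_real_derivative 4*l*u0 - (((- 3 * v0 / l) * v2 + u0 * (4*l*u2 - 3 * u2 / l)) * u2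
      - u0* v2*(- 3 * v2 / l))/(u2*u2)) (at t)"
    unfolding shape_one_def 
    by (rule derivative_eq_intros D refl | (use d in \<open>simp add: defs[symmetric]\<close>))+
  moreover have "4*l*u0 - (((- 3 * v0 / l) * v2 + u0 * (4*l*u2 - 3 * u2 / l)) * u2
      - u0* v2*(- 3 * v2 / l))/(u2*u2) = - (3 / l^3) * (u1* v0 - v1*u0)"
  proof -
    have u2: "u2 * u2 = l*l* v1" using d(6) by (simp add: power2_eq_square)
    have "l\<^sup>2 * u0 * v1 + v2 * (v0*u2 - u0* v2) = v1 * (v1*u0 - u1* v0)"
      using d(5,6,8) by algebra
    then have k: "l\<^sup>2 * u0 + v2 * (v0*u2 - u0* v2) / v1 = v1*u0 - u1* v0" using d(3) by (simp add: field_simps)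
    have "4*l*u0 - (((- 3 * v0 / l) * v2 + u0 * (4*l*u2 - 3 * u2 / l)) * u2
      - u0* v2*(- 3 * v2 / l))/(u2*u2) = 3*u0/l + 3* v2*(v0*u2-u0* v2)/(l*(u2*u2))"
      using d(1,2) by (simp add: field_simps)
    also have "\<dots> = 3/l^3 * (l\<^sup>2 * u0 + v2 * (v0*u2 - u0* v2) / v1)"
      unfolding u2 using d(1,3) by (simp add: field_simps power2_eq_square power3_eq_cube)
    finally show ?thesis unfolding k by (metis minus_diff_eq minus_mult_commute)
  qed
  moreover have "- (3 / l^3) * (u1* v0 - v1*u0) = - (3 * sqrt (v t $ 1) / (lam t)^3) * shape_two (u t) (v t)"
    unfolding shape_two_def using d(3) by (simp add: defs[symmetric])
  ultimately show ?thesis by simp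
qed

text \<open>The numerator \<open>u\<^sub>1v\<^sub>0 - v\<^sub>1u\<^sub>0\<close> has the derivative \<open>2\<lambda>v\<^sub>0\<close>; together with the
  derivative of \<open>1/\<mu>\<close>, the constraints \<open>|u|\<^sup>2 = v\<^sub>1\<close> and \<open>\<langle>u,v\<rangle> = 0\<close> produce the numerator of \<open>w\<^sub>1\<close>.\<close>
lemma shape_two_deriv:
  assumes "nk_structure_on S lam u v" "t \<in> S"
  shows "((\<lambda>s. shape_two (u s) (v s)) has_real_derivative
     (2 * (lam t)^3 / sqrt (v t $ 1)) * shape_one (u t) (v t)) (at t)"
proof -
  note d = nk_structureD[OF assms] and D = nk_structure_derivs[OF assms]
  define l u0 u1 u2 v0 v1 v2 where defs: "l = lam t" "u0 = u t $ 0" "u1 = u t $ 1" "u2 = u t $ 2"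
    "v0 = v t $ 0" "v1 = v t $ 1" "v2 = v t $ 2"
  note d = d[folded defs] and D = D[folded defs]
  define m where "m = sqrt v1"
  have m: "m > 0" "v1 = m*m" using d(3) unfolding m_def by auto
  have sq: "((\<lambda>s. sqrt (v s $ 1)) has_real_derivative (2 * l * u1 / m)) (at t)"
    by (rule derivative_eq_intros D refl | (use d m in \<open>simp add: defs[symmetric] m_def[symmetric] field_simps\<close>))+
  have num: "((\<lambda>s. u s $ 1 * v s $ 0 - v s $ 1 * u s $ 0) has_real_derivative 2 * l * v0) (at t)"
    by (rule derivative_eq_intros D refl | (use d m in \<open>simp add: defs[symmetric] field_simps\<close>))+
  have "((\<lambda>s. shape_two (u s) (v s)) has_real_derivative (2*l* v0 * m - (u1* v0 - v1*u0)*(2*l*u1/m)) / (m*m)) (at t)"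
    unfolding shape_two_def using DERIV_divide[OF num sq] m by (simp add: defs[symmetric] m_def[symmetric])
  moreover have "(2*l* v0 * m - (u1* v0 - v1*u0)*(2*l*u1/m)) / (m*m) = (2 * l^3 / m) * (v0 - u0* v2/u2)"
  proof -
    have k: "v0 * v1 - u1*(u1* v0 - v1*u0) = u2 * (u2* v0 - u0* v2)"
      using d(5,7) by algebra
    have "(2*l* v0 * m - (u1* v0 - v1*u0)*(2*l*u1/m)) / (m*m) = 2*l*(v0 * v1 - u1*(u1* v0 - v1*u0)) / (m*(m*m))"
      using m by (simp add: field_simps)
    also have "\<dots> = 2 * l * (u2*u2) / (m * v1) * (v0 - u0* v2/u2)"
      unfolding k using d(2) m by (simp add: field_simps)
    also have "\<dots> = (2 * l^3 / m) * (v0 - u0* v2/u2)"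
      unfolding d(6)[unfolded power2_eq_square, symmetric] using d(3) by (simp add: field_simps power3_eq_cube)
    finally show ?thesis .
  qed
  ultimately show ?thesis
    unfolding shape_one_def by (simp add: defs[symmetric] m_def[symmetric])
qed

text \<open>On the constraint variety \<open>\<lambda>\<mu>\<^sup>2 = - u\<^sub>2\<mu>\<close>, and the system gives the derivatives of \<open>u\<^sub>2\<close> and of \<open>\<mu> = \<surd>v\<^sub>1\<close>.\<close>
lemma volume_deriv:
  assumes "nk_structure_on S lam u v" "t \<in> S" "open S"
  shows "((\<lambda>s. lam s * (nk_mu (u s))\<^sup>2) has_real_derivative
    sqrt (v t $ 1) / lam t * volume_speed (u t) (v t)) (at t)"
proof -
  note d = nk_structureD[OF assms(1,2)] and D = nk_structure_derivs[OF assms(1,2)]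
  define l u0 u1 u2 v0 v1 v2 where defs: "l = lam t" "u0 = u t $ 0" "u1 = u t $ 1" "u2 = u t $ 2"
    "v0 = v t $ 0" "v1 = v t $ 1" "v2 = v t $ 2"
  note d = d[folded defs] and D = D[folded defs]
  define m where "m = sqrt v1"
  have m: "m > 0" "v1 = m*m" using d(3) unfolding m_def by auto
  have sq: "((\<lambda>s. sqrt (v s $ 1)) has_real_derivative (2 * l * u1 / m)) (at t)"
    by (rule derivative_eq_intros D refl | (use d m in \<open>simp add: defs[symmetric] m_def[symmetric] field_simps\<close>))+
  have vol: "lam s * (nk_mu (u s))\<^sup>2 = - u s $ 2 * sqrt (v s $ 1)" if "s \<in> S" for s
    using u2_eq_neg_lam_mu[OF assms(1) that] nk_structureD[OF assms(1) that]
    unfolding nk_mu_def by simp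
  have u2: "u2 = - (l * m)" using u2_eq_neg_lam_mu[OF assms(1,2)] by (simp add: defs m_def)
  have "((\<lambda>s. - u s $ 2 * sqrt (v s $ 1)) has_real_derivative 3 * v2 / l * m - u2 * (2 * l * u1 / m)) (at t)"
    by (rule derivative_eq_intros D sq refl | (use d m in \<open>simp add: defs[symmetric] m_def[symmetric] field_simps\<close>))+
  moreover have "3 * v2 / l * m - u2 * (2 * l * u1 / m) = m / l * (3 * v2 - 2 * u2^3 * u1 / v1\<^sup>2)"
    unfolding u2 m(2) using m(1) d(1) by (simp add: field_simps power2_eq_square power3_eq_cube)
  ultimately have "((\<lambda>s. - u s $ 2 * sqrt (v s $ 1)) has_real_derivative
     sqrt (v t $ 1) / lam t * volume_speed (u t) (v t)) (at t)"
    unfolding volume_speed_def by (simp add: defs[symmetric] m_def[symmetric])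
  then show ?thesis
    by (rule has_field_derivative_transform_within_open[OF _ assms(3,2)]) (simp add: vol)
qed

section \<open>Nondegeneracy of critical points of the orbit volume\<close>

text \<open>The variables are \<open>L = \<lambda>\<^sup>2\<close>, \<open>m = \<mu>\<^sup>2\<close> and \<open>y = u\<^sub>1\<^sup>2/\<mu>\<^sup>2\<close> at a critical point of the orbit
  volume. There \<open>v\<^sub>2\<close> is determined by the others, and the constraints give \<open>u\<^sub>0\<^sup>2 = m (y + L - 1)\<close> and
  \<open>v\<^sub>0\<^sup>2 = m\<^sup>2 + (4/9) L\<^sup>3 y - L m\<close>; the hypothesis \<open>rel\<close> says that their product is the square of
  \<open>u\<^sub>0v\<^sub>0 = u\<^sub>1v\<^sub>1 + u\<^sub>2v\<^sub>2\<close>. The conclusion is the sign of the second derivative of the volume. For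
  \<open>L < 1\<close> the term \<open>m (18 L - 9)\<close> may be negative, but then \<open>rel\<close> forces \<open>y > 1\<close> and
  bounds \<open>m\<close> by \<open>(4/9) L\<^sup>2 y\<close>, so the term in \<open>y\<close> dominates.\<close>
lemma critical_inequality:
  fixes L m y :: real
  assumes pos: "L > 0" "m > 0" "y \<ge> 0"
    and u0: "y + L \<ge> 1" and v0: "m\<^sup>2 + 4/9 * L^3 * y \<ge> L * m"
    and rel: "(L - 1) * m * (m - L) = y * (4/3 * m * L\<^sup>2 + L * m + 4/9 * L^3 * (1 - y))"
  shows "m * (18 * L - 9) + 28 * L\<^sup>2 * y > 4 * L\<^sup>2"
proof (cases "L \<ge> 1")
  case True
  have a: "m * (18 * L - 9) \<ge> m * (9 * L)" using True pos by (intro mult_left_mono) auto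
  show ?thesis
  proof (cases "9 * m + 28 * L * y > 4 * L")
    case True
    then have "L * (9 * m + 28 * L * y) > L * (4 * L)" using pos by simp
    then show ?thesis using a by (simp add: algebra_simps power2_eq_square)
  next
    case False
    have "28 * L * y \<le> 4 * L" using False pos by linarith
    then have "28 * y \<le> 4" using pos by (simp add: mult.assoc mult.left_commute[of _ L])
    then have y1: "y < 1" by simp
    have "28 * L * y \<ge> 0" using pos by simp
    then have mL: "m < L" using False pos by linarith
    have "(L - 1) * m * (m - L) \<le> 0"
      using \<open>L \<ge> 1\<close> pos mL by (simp add: mult_nonneg_nonpos)
    moreover have "4/3 * m * L\<^sup>2 + L * m + 4/9 * L^3 * (1 - y) > 0"
      using pos y1 by (simp add: add_pos_pos)
    ultimately have "y = 0" using rel pos by (smt (verit) mult_pos_pos)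
    then have "m * m \<ge> L * m" using v0 by (simp add: power2_eq_square)
    then show ?thesis using mL pos by simp
  qed
next
  case False
  then have L1: "L < 1" and y0: "y > 0" using u0 by auto
  have y1: "y > 1"
  proof (rule ccontr)
    assume "\<not> y > 1"
    then have "4/9 * L^3 * (1 - y) \<ge> 0" using pos by simp
    then have "y * (4/3 * m * L\<^sup>2 + L * m + 4/9 * L^3 * (1 - y)) \<ge> y * (L * m)"
      using pos by (intro mult_left_mono) auto
    moreover have "y * (L * m) \<ge> (1 - L) * (L * m)" using u0 pos by (intro mult_right_mono) auto
    ultimately have "(1 - L) * m * (L - m) \<ge> (1 - L) * m * L" using rel by (simp add: algebra_simps)
    then show False using L1 pos by simp
  qed
  have "m * (L * (y - 1)) \<le> m * (y * (4/3 * L\<^sup>2 + L) - (1 - L) * (L - m))"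
  proof (rule mult_left_mono)
    have "y * (4/3 * L\<^sup>2 + L) - (1 - L) * (L - m) - L * (y - 1) = 4/3 * (y * L\<^sup>2) + (1 - L) * m + L\<^sup>2"
      by algebra
    moreover have "y * L\<^sup>2 \<ge> 0" "(1 - L) * m \<ge> 0" "L\<^sup>2 \<ge> 0" using pos L1 by auto
    ultimately show "L * (y - 1) \<le> y * (4/3 * L\<^sup>2 + L) - (1 - L) * (L - m)" by linarith
  qed (use pos in auto)
  also have "\<dots> = 4/9 * L\<^sup>2 * y * (L * (y - 1))"
    using rel by algebra
  finally have "m * (L * (y - 1)) \<le> 4/9 * L\<^sup>2 * y * (L * (y - 1))" .
  then have "m \<le> 4/9 * L\<^sup>2 * y" by (rule mult_right_le_imp_le) (use y1 pos in simp)
  moreover have "L\<^sup>2 * y > L\<^sup>2" using y1 pos by simp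
  moreover have "L * m > 0" using pos by simp
  moreover have "L\<^sup>2 * y > 0" using y0 pos by simp
  ultimately show ?thesis by (simp add: algebra_simps)
qed

text \<open>At a zero of \<open>volume_speed\<close> its derivative is the negative number \<open>u\<^sub>2/(\<lambda>\<mu>\<^sup>2)\<close> times the
  positive quantity of \<open>critical_inequality\<close>.\<close>
lemma volume_speed_deriv_at_zero:
  assumes "nk_structure_on S lam u v" "t \<in> S" "volume_speed (u t) (v t) = 0"
  obtains D where "D < 0" "((\<lambda>s. volume_speed (u s) (v s)) has_real_derivative D) (at t)"
proof -
  note d = nk_structureD[OF assms(1,2)] and D = nk_structure_derivs[OF assms(1,2)]
  define l u0 u1 u2 v0 v1 v2 where defs: "l = lam t" "u0 = u t $ 0" "u1 = u t $ 1" "u2 = u t $ 2"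
    "v0 = v t $ 0" "v1 = v t $ 1" "v2 = v t $ 2"
  note d = d[folded defs] and D = D[folded defs]
  define L y where Ly: "L = l\<^sup>2" "y = u1\<^sup>2 / v1"
  have u1y: "u1\<^sup>2 = y * v1" using d(3) by (simp add: Ly)
  have u2L: "u2\<^sup>2 = L * v1" using d(6) by (simp add: Ly)
  have "3 * v2 = 2 * u2 * u2\<^sup>2 * u1 / v1\<^sup>2"
    using assms(3) by (simp add: volume_speed_def defs power2_eq_square power3_eq_cube)
  then have v2: "v2 = 2/3 * L * u2 * u1 / v1"
    unfolding u2L using d(3) by (simp add: field_simps power2_eq_square)
  \<comment> \<open>Substitute this value of \<open>v2\<close> into the constraints, to obtain the hypotheses of \<open>critical_inequality\<close>.\<close>
  have v2': "v2\<^sup>2 = 4/9 * L^3 * y"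
  proof -
    have "v2\<^sup>2 = 4/9 * L\<^sup>2 * u2\<^sup>2 * u1\<^sup>2 / v1\<^sup>2"
      unfolding v2 by (simp add: power_mult_distrib power_divide)
    also have "\<dots> = 4/9 * L^3 * y"
      unfolding u2L u1y using d(3) by (simp add: field_simps power2_eq_square power3_eq_cube)
    finally show ?thesis .
  qed
  have u0': "u0\<^sup>2 = v1 * (y + L - 1)" using d(7) unfolding u1y u2L by (simp add: algebra_simps)
  have v0': "v0\<^sup>2 = v1\<^sup>2 + 4/9 * L^3 * y - L * v1" using d(8) unfolding v2' u2L .
  have uv: "u0 * v0 = u1 * (v1 + 2/3 * L\<^sup>2)"
  proof -
    have "u2 * v2 = 2/3 * L * u2\<^sup>2 * u1 / v1" unfolding v2 by (simp add: power2_eq_square)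
    also have "\<dots> = 2/3 * L\<^sup>2 * u1" unfolding u2L using d(3) by (simp add: power2_eq_square)
    finally show ?thesis using d(5) by (simp add: algebra_simps)
  qed
  have "u0\<^sup>2 * v0\<^sup>2 = u1\<^sup>2 * (v1 + 2/3 * L\<^sup>2)\<^sup>2"
    unfolding power_mult_distrib[symmetric] uv ..
  then have "v1 * ((y + L - 1) * (v1\<^sup>2 + 4/9 * L^3 * y - L * v1)) = v1 * (y * (v1 + 2/3 * L\<^sup>2)\<^sup>2)"
    unfolding u0' v0' u1y by (simp add: mult_ac)
  then have "(y + L - 1) * (v1\<^sup>2 + 4/9 * L^3 * y - L * v1) = y * (v1 + 2/3 * L\<^sup>2)\<^sup>2"
    using d(3) by simp
  then have rel: "(L - 1) * v1 * (v1 - L) = y * (4/3 * v1 * L\<^sup>2 + L * v1 + 4/9 * L^3 * (1 - y))"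
    by algebra
  have ineq: "v1 * (18 * L - 9) + 28 * L\<^sup>2 * y > 4 * L\<^sup>2"
  proof (rule critical_inequality[OF _ _ _ _ _ rel])
    show "L > 0" "y \<ge> 0" using d(1,3) by (auto simp: Ly)
    show "v1 > 0" by (rule d)
    have "v1 * (y + L - 1) \<ge> 0" using u0' by (metis zero_le_power2)
    then show "1 \<le> y + L" using d(3) by (simp add: zero_le_mult_iff)
    show "L * v1 \<le> v1\<^sup>2 + 4/9 * L^3 * y" using v0' by (smt (verit) zero_le_power2)
  qed
  define E where "E = 3 * (4 * l * u2 - 3 * u2 / l)
      - ((2 * (3 * u2\<^sup>2 * (- 3 * v2 / l)) * u1 + 2 * u2^3 * (2 * l - 3 * v1 / l)) * v1\<^sup>2
          - 2 * u2^3 * u1 * (2 * v1 * (4 * l * u1))) / (v1\<^sup>2 * v1\<^sup>2)"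
  have "((\<lambda>s. volume_speed (u s) (v s)) has_real_derivative E) (at t)"
    unfolding volume_speed_def E_def
    by (rule derivative_eq_intros D refl | (use d in \<open>simp add: defs[symmetric] field_simps\<close>))+
  moreover have "E = u2 / (l * v1) * (v1 * (18 * L - 9) + 28 * L\<^sup>2 * y - 4 * L\<^sup>2)"
  proof -
    have u23: "u2^3 = L * v1 * u2" using u2L by (simp add: power3_eq_cube power2_eq_square)
    have "E = 3 * (4 * l * u2 - 3 * u2 / l) + 18 * u2\<^sup>2 * v2 * u1 / (l * v1\<^sup>2)
      - 2 * u2^3 * (2 * l - 3 * v1 / l) / v1\<^sup>2 + 16 * l * u2^3 * u1\<^sup>2 / v1^3"
      unfolding E_def using d(1,3) by (simp add: field_simps power2_eq_square power3_eq_cube)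
    also have "18 * u2\<^sup>2 * v2 * u1 / (l * v1\<^sup>2) = 12 * L\<^sup>2 * u2 * u1\<^sup>2 / (l * v1\<^sup>2)"
      unfolding u2L v2 using d(1,3) by (simp add: field_simps power2_eq_square)
    also have "12 * L\<^sup>2 * u2 * u1\<^sup>2 / (l * v1\<^sup>2) = 12 * L\<^sup>2 * u2 * y / (l * v1)"
      unfolding u1y using d(1,3) by (simp add: field_simps power2_eq_square)
    also have "16 * l * u2^3 * u1\<^sup>2 / v1^3 = 16 * L\<^sup>2 * u2 * y / (l * v1)"
      unfolding u23 u1y using d(1,3) by (simp add: Ly(1) field_simps power2_eq_square power3_eq_cube)
    also have "2 * u2^3 * (2 * l - 3 * v1 / l) / v1\<^sup>2 = u2 * (4 * L\<^sup>2 - 6 * L * v1) / (l * v1)"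
      unfolding u23 using d(1,3) by (simp add: Ly(1) field_simps power2_eq_square)
    also have "3 * (4 * l * u2 - 3 * u2 / l) = u2 * (12 * L - 9) * v1 / (l * v1)"
      using d(1,3) by (simp add: Ly(1) field_simps power2_eq_square)
    finally show ?thesis using d(1,3) by (simp add: diff_divide_distrib add_divide_distrib algebra_simps)
  qed
  moreover have "u2 / (l * v1) * (v1 * (18 * L - 9) + 28 * L\<^sup>2 * y - 4 * L\<^sup>2) < 0"
    using ineq d(1,2,3) by (intro mult_neg_pos divide_neg_pos) auto
  ultimately show ?thesis using that by metis
qed

lemma is_max_volume_time_iff:
  assumes "nk_structure_on {0<..<R} lam u v" "is_max_volume_time R lam u T"
  shows "0 < T" "T < R" "\<And>t. 0 < t \<Longrightarrow> t < R \<Longrightarrow> volume_speed (u t) (v t) = 0 \<longleftrightarrow> t = T"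
proof -
  show "0 < T" "T < R" using assms(2) unfolding is_max_volume_time_def by auto
  fix t assume t: "0 < t" "t < R"
  then have m: "t \<in> {0<..<R}" by simp
  have "deriv (\<lambda>s. lam s * (nk_mu (u s))\<^sup>2) t = sqrt (v t $ 1) / lam t * volume_speed (u t) (v t)"
    by (rule DERIV_imp_deriv[OF volume_deriv[OF assms(1) m open_greaterThanLessThan]])
  moreover have "deriv (\<lambda>s. lam s * (nk_mu (u s))\<^sup>2) t = 0 \<longleftrightarrow> t = T"
    using assms(2) m unfolding is_max_volume_time_def by blast
  ultimately show "volume_speed (u t) (v t) = 0 \<longleftrightarrow> t = T"
    using nk_structureD(1,3)[OF assms(1) m] by simp
qed

section \<open>Behaviour near the singular orbit\<close>

lemma bigo_at_zero_value:
  fixes f :: "real \<Rightarrow> real"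
  assumes "isCont f 0" "(\<lambda>t. f t - c) \<in> O[at_right 0](\<lambda>t. t ^ 2)"
  shows "f 0 = c"
proof -
  have "(\<lambda>t::real. t ^ 2) \<in> o[at_right 0](\<lambda>_. 1)"
    by (rule smalloI_tendsto) (auto intro!: tendsto_eq_intros)
  then have "(\<lambda>t. f t - c) \<in> o[at_right 0](\<lambda>_. 1)"
    by (rule landau_o.big_small_trans[OF assms(2)])
  then have "((\<lambda>t. f t - c) \<longlongrightarrow> 0) (at_right 0)" using smalloD_tendsto by fastforce
  then have "(f \<longlongrightarrow> c) (at_right 0)" by (simp add: LIM_zero_iff)
  moreover have "(f \<longlongrightarrow> f 0) (at_right 0)"
    using assms(1) unfolding isCont_def by (rule filterlim_mono[OF _ order_refl at_le]) simp
  ultimately show ?thesis using tendsto_unique trivial_limit_at_right_real by blast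
qed

lemma bigo_at_zero_slope:
  fixes f :: "real \<Rightarrow> real"
  assumes "(\<lambda>t. f t - c * t) \<in> O[at_right 0](\<lambda>t. t ^ 3)"
  shows "((\<lambda>t. f t / t) \<longlongrightarrow> c) (at_right 0)"
proof -
  have ev: "eventually (\<lambda>t::real. t > 0) (at_right 0)" by (simp add: eventually_at_right_less)
  have "(\<lambda>t::real. t ^ 3) \<in> o[at_right 0](\<lambda>t. t)"
  proof (rule smalloI_tendsto)
    have "((\<lambda>t::real. t ^ 2) \<longlongrightarrow> 0) (at_right 0)" by (auto intro!: tendsto_eq_intros)
    then show "((\<lambda>t::real. t ^ 3 / t) \<longlongrightarrow> 0) (at_right 0)"
      by (rule Lim_transform_eventually)
        (use ev in eventually_elim, auto simp: power2_eq_square power3_eq_cube)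
  qed (use ev in eventually_elim, auto)
  then have "(\<lambda>t. f t - c * t) \<in> o[at_right 0](\<lambda>t. t)"
    by (rule landau_o.big_small_trans[OF assms])
  then have "((\<lambda>t. (f t - c * t) / t) \<longlongrightarrow> 0) (at_right 0)" by (rule smalloD_tendsto)
  then have "((\<lambda>t. f t / t - c) \<longlongrightarrow> 0) (at_right 0)"
    by (rule Lim_transform_eventually) (use ev in eventually_elim, auto simp: field_simps)
  then show ?thesis by (simp add: LIM_zero_iff)
qed

lemma nk_closing_isCont:
  assumes "nk_closing_S3 b R lam u v" "t \<in> {-R<..<R}"
  shows "isCont lam t" "isCont (\<lambda>s. u s $ i) t" "isCont (\<lambda>s. v s $ i) t"
proof -
  have "smooth_real_on {-R<..<R} lam" "smooth_real_on {-R<..<R} (\<lambda>s. u s $ i)"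
    "smooth_real_on {-R<..<R} (\<lambda>s. v s $ i)"
    using assms(1) unfolding nk_closing_S3_def smooth_triple_on_def by auto
  then show "isCont lam t" "isCont (\<lambda>s. u s $ i) t" "isCont (\<lambda>s. v s $ i) t"
    using smooth_real_onD DERIV_isCont assms(2) by metis+
qed

lemma nk_closing_values:
  assumes "nk_closing_S3 b R lam u v"
  shows "R > 0" "nk_structure_on {0<..<R} lam u v" "lam 0 = b" "u 0 = 0"
    "v 0 $ 0 = - (2/3) * b^3" "v 0 $ 1 = 0" "v 0 $ 2 = (2/3) * b^3"
proof -
  show R: "R > 0" and "nk_structure_on {0<..<R} lam u v" and "lam 0 = b"
    using assms unfolding nk_closing_S3_def by auto
  have z: "0 \<in> {-R<..<R}" using R by auto
  have "u (- 0) = - u 0" using assms z unfolding nk_closing_S3_def by blast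
  then show "u 0 = 0" by (simp add: vec_eq_iff)
  note c = nk_closing_isCont(3)[OF assms z]
  have o: "(\<lambda>t. v t $ 0 - (- (2 / 3) * b ^ 3)) \<in> O[at_right 0](\<lambda>t. t ^ 2)"
     "(\<lambda>t. v t $ 1 - 0) \<in> O[at_right 0](\<lambda>t. t ^ 2)"
     "(\<lambda>t. v t $ 2 - (2 / 3) * b ^ 3) \<in> O[at_right 0](\<lambda>t. t ^ 2)"
    using assms unfolding nk_closing_S3_def by auto
  show "v 0 $ 0 = - (2/3) * b^3" "v 0 $ 1 = 0" "v 0 $ 2 = (2/3) * b^3"
    by (rule bigo_at_zero_value[OF c o(1)], rule bigo_at_zero_value[OF c o(2)],
        rule bigo_at_zero_value[OF c o(3)])
qed

text \<open>Both \<open>u\<^sub>0\<close> and \<open>u\<^sub>2\<close> vanish at \<open>0\<close>, but their slopes are opposite, so \<open>u\<^sub>0v\<^sub>2/u\<^sub>2\<close> tends to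
  \<open>- v\<^sub>2(0) = v\<^sub>0(0)\<close>.\<close>
lemma shape_one_tendsto_0:
  assumes "nk_closing_S3 b R lam u v" "b > 0"
  shows "((\<lambda>t. shape_one (u t) (v t)) \<longlongrightarrow> 0) (at_right 0)"
proof -
  note val = nk_closing_values[OF assms(1)]
  have z: "0 \<in> {-R<..<R}" using val(1) by auto
  have c: "((\<lambda>t. v t $ i) \<longlongrightarrow> v 0 $ i) (at_right 0)" for i
    using nk_closing_isCont(3)[OF assms(1) z] unfolding isCont_def
    by (rule filterlim_mono[OF _ order_refl at_le]) simp
  have ev: "eventually (\<lambda>t::real. t > 0) (at_right 0)" by (simp add: eventually_at_right_less)
  have "(\<lambda>t. u t $ 0 - (2 * b\<^sup>2) * t) \<in> O[at_right 0](\<lambda>t. t ^ 3)"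
    "(\<lambda>t. u t $ 2 - (- 2 * b\<^sup>2) * t) \<in> O[at_right 0](\<lambda>t. t ^ 3)"
    using assms unfolding nk_closing_S3_def by auto
  note s = this[THEN bigo_at_zero_slope]
  have "((\<lambda>t. v t $ 0 - (u t $ 0 / t) * v t $ 2 / (u t $ 2 / t)) \<longlongrightarrow>
      v 0 $ 0 - (2 * b\<^sup>2) * v 0 $ 2 / (- 2 * b\<^sup>2)) (at_right 0)"
    using assms(2) by (intro tendsto_intros s c) simp
  moreover have "v 0 $ 0 - (2 * b\<^sup>2) * v 0 $ 2 / (- 2 * b\<^sup>2) = 0"
    unfolding val using assms(2) by (simp add: field_simps)
  ultimately have "((\<lambda>t. v t $ 0 - (u t $ 0 / t) * v t $ 2 / (u t $ 2 / t)) \<longlongrightarrow> 0) (at_right 0)"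
    by simp
  then show ?thesis
    by (rule Lim_transform_eventually)
      (use ev in eventually_elim, auto simp: shape_one_def)
qed

text \<open>While \<open>shape_two < 0\<close>, the function \<open>shape_one\<close> increases strictly from its limit \<open>0\<close> at the singular orbit.\<close>
lemma shape_one_pos_while_shape_two_neg:
  assumes cl: "nk_closing_S3 b R lam u v" "b > 0"
    and c: "0 < c" "c < R"
    and neg: "\<And>t. 0 < t \<Longrightarrow> t \<le> c \<Longrightarrow> shape_two (u t) (v t) < 0"
  shows "shape_one (u c) (v c) > 0"
proof -
  note st = nk_closing_values(2)[OF cl(1)]
  have inc: "shape_one (u s) (v s) < shape_one (u t) (v t)" if "0 < s" "s < t" "t \<le> c" for s t
  proof (rule DERIV_pos_imp_increasing[OF that(2)])
    fix x assume x: "s \<le> x" "x \<le> t"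
    have xR: "x \<in> {0<..<R}" using x that c by auto
    have "- (3 * sqrt (v x $ 1) / (lam x)^3) * shape_two (u x) (v x) > 0"
      using nk_structureD(1,3)[OF st xR] neg[of x] x that
      by (intro mult_neg_neg) auto
    then show "\<exists>y. ((\<lambda>s. shape_one (u s) (v s)) has_real_derivative y) (at x) \<and> y > 0"
      using shape_one_deriv[OF st xR] by blast
  qed
  have "shape_one (u (c/2)) (v (c/2)) \<ge> 0"
  proof (rule tendsto_upperbound[OF shape_one_tendsto_0[OF cl]])
    show "\<forall>\<^sub>F t in at_right 0. shape_one (u t) (v t) \<le> shape_one (u (c/2)) (v (c/2))"
      unfolding eventually_at_right_field using inc[of _ "c/2"] c by (intro exI[of _ "c/2"]) (auto intro: less_imp_le)
  qed simp
  with inc[of "c/2" c] c show ?thesis by simp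
qed

text \<open>This is stated with explicit bounds around a parameter value \<open>a\<close>, rather than as an expansion at a fixed \<open>b\<close>, so
  that the range of times does not depend on \<open>b\<close>. The bounds make \<open>u\<^sub>1\<close> increasing from \<open>0\<close>, and then
  \<open>v\<^sub>1' = 4\<lambda>u\<^sub>1\<close> gives \<open>v\<^sub>1 \<le> 8ac u\<^sub>1\<close>. Hence in \<open>u\<^sub>1v\<^sub>0 - v\<^sub>1u\<^sub>0\<close> the negative first term wins
  as soon as \<open>c \<le> a\<^sup>2/24\<close>.\<close>
lemma initial_behaviour:
  assumes cl: "nk_closing_S3 b R lam u v" "b > 0"
    and c: "0 < c" "c < R"
    and near: "\<And>t. 0 < t \<Longrightarrow> t \<le> c \<Longrightarrow>
      lam t < 2 * a \<and> a / 2 < lam t \<and> v t $ 1 < a\<^sup>2 / 12 \<and> \<bar>u t $ 0\<bar> < 1 \<and> v t $ 0 < - (a^3 / 3) \<and> v t $ 2 > 0"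
    and ca: "c \<le> a\<^sup>2 / 24"
  shows "shape_two (u c) (v c) < 0" "volume_speed (u c) (v c) > 0"
proof -
  note st = nk_closing_values(2)[OF cl(1)] and val = nk_closing_values[OF cl(1)]
  have cc: "continuous_on {0..c} (\<lambda>s. u s $ i)" "continuous_on {0..c} (\<lambda>s. v s $ i)" for i
    by (rule continuous_at_imp_continuous_on, use nk_closing_isCont(2,3)[OF cl(1)] c in auto)+
  have a: "a > 0" using near[of c] c by auto
  have incr: "u s $ 1 < u t $ 1" if st': "0 \<le> s" "s < t" "t \<le> c" for s t
  proof (rule DERIV_pos_imp_increasing_open[OF st'(2)])
    fix x assume x: "s < x" "x < t"
    have xR: "x \<in> {0<..<R}" using x st' c by auto
    have n: "a / 2 < lam x" "v x $ 1 < a\<^sup>2 / 12" using near[of x] x st' by auto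
    have "(a/2) * (a/2) < lam x * lam x" using n a by (intro mult_strict_mono) auto
    then have "a\<^sup>2 < 4 * (lam x)\<^sup>2" by (simp add: power2_eq_square)
    then have "3 * v x $ 1 < 2 * (lam x)\<^sup>2"
      using n(2) zero_le_power2[of "lam x"] by linarith
    then have "2 * lam x - 3 * v x $ 1 / lam x > 0"
      using n(1) a by (simp add: field_simps power2_eq_square)
    then show "\<exists>y. ((\<lambda>s. u s $ 1) has_real_derivative y) (at x) \<and> y > 0"
      using nk_structure_derivs(2)[OF st xR] by blast
  next
    show "continuous_on {s..t} (\<lambda>s. u s $ 1)" 
      by (rule continuous_on_subset[OF cc(1)]) (use st' in auto)
  qed
  have u1: "u c $ 1 > 0" using incr[of 0 c] c val(4) by simp
  have v1: "v c $ 1 \<le> 8 * a * c * u c $ 1"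
  proof -
    obtain x where x: "0 < x" "x < c" and "v c $ 1 - v 0 $ 1 = (c - 0) * (4 * lam x * u x $ 1)"
    proof (rule mvt[OF c(1) cc(2)[of 1]])
      fix x assume x: "0 < x" "x < c"
      have xR: "x \<in> {0<..<R}" using x c by auto
      show "((\<lambda>s. v s $ 1) has_derivative (\<lambda>h. h * (4 * lam x * u x $ 1))) (at x)"
        using nk_structure_derivs(5)[OF st xR] 
        by (rule has_derivative_eq_rhs[OF has_field_derivative_imp_has_derivative]) (auto simp: mult.commute)
    qed
    then have "v c $ 1 = 4 * c * (lam x * u x $ 1)" using val(6) by simp
    also have "\<dots> \<le> 4 * c * ((2 * a) * u c $ 1)"
      using near[of x] x c a u1 incr[of x c] incr[of 0 x] val(4)
      by (intro mult_left_mono mult_mono) auto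
    finally show ?thesis by (simp add: mult_ac)
  qed
  have cR: "c \<in> {0<..<R}" using c by auto
  note d = nk_structureD[OF st cR]
  have n: "\<bar>u c $ 0\<bar> < 1" "v c $ 0 < - (a^3 / 3)" "v c $ 2 > 0" using near[of c] c by auto
  have "\<bar>v c $ 1 * u c $ 0\<bar> \<le> v c $ 1 * 1"
    unfolding abs_mult using n d(3) by (intro mult_mono) auto
  also have "\<dots> \<le> u c $ 1 * (8 * a * (a\<^sup>2 / 24))"
    using order_trans[OF v1, of "8 * a * (a\<^sup>2/24) * u c $ 1"] ca a u1 by (simp add: mult_ac)
  also have "\<dots> = u c $ 1 * (a^3 / 3)" by (simp add: power2_eq_square power3_eq_cube)
  finally have "v c $ 1 * u c $ 0 \<ge> - (u c $ 1 * (a^3 / 3))" by linarith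
  moreover have "u c $ 1 * v c $ 0 < u c $ 1 * (- (a^3 / 3))"
    using n u1 by (intro mult_strict_left_mono) auto
  ultimately have "u c $ 1 * v c $ 0 - v c $ 1 * u c $ 0 < 0" by simp
  then show "shape_two (u c) (v c) < 0" unfolding shape_two_def using d(3) by (simp add: divide_neg_pos)
  have "(u c $ 2)^3 * u c $ 1 / (v c $ 1)\<^sup>2 < 0"
    using d u1 by (intro divide_neg_pos mult_neg_pos) (auto simp: power3_eq_cube mult_neg_pos mult_neg_neg mult_pos_neg)
  then show "volume_speed (u c) (v c) > 0" unfolding volume_speed_def using n by simp
qed

text \<open>Joint continuity at \<open>(a, 0)\<close> supplies the bounds of \<open>initial_behaviour\<close> for all \<open>(b, t)\<close> close to \<open>(a, 0)\<close> at once.\<close>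
lemma family_near_start:
  fixes lam :: "real \<Rightarrow> real \<Rightarrow> real" and u v :: "real \<Rightarrow> real \<Rightarrow> real^3"
  assumes cl: "\<And>b. b > 0 \<Longrightarrow> nk_closing_S3 b (R b) (lam b) (u b) (v b)"
    and cont: "continuous_on {(b, t). 0 < b \<and> 0 \<le> t \<and> t < R b} (\<lambda>(b, t). (lam b t, u b t, v b t))"
    and a: "a > 0"
  shows "\<exists>e>0. \<forall>b t. \<bar>b - a\<bar> < e \<longrightarrow> 0 < b \<longrightarrow> 0 < t \<longrightarrow> t < e \<longrightarrow> t < R b \<longrightarrow>
    shape_one (u b t) (v b t) > 0 \<and> volume_speed (u b t) (v b t) > 0"
proof -
  let ?D = "{(b, t). 0 < b \<and> 0 \<le> t \<and> t < R b}"
  note val = nk_closing_values[OF cl[OF a]]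
  have mem: "(a, 0) \<in> ?D" using a val(1) by simp
  have lim: "((\<lambda>(b, t). (lam b t, u b t, v b t)) \<longlongrightarrow> (lam a 0, u a 0, v a 0)) (at (a, 0) within ?D)"
    using cont mem unfolding continuous_on_def by fastforce
  note tl = tendsto_fst[OF lim] and tu = tendsto_vec_nth[OF tendsto_fst[OF tendsto_snd[OF lim]]]
    and tv = tendsto_vec_nth[OF tendsto_snd[OF tendsto_snd[OF lim]]]
  have ts: "((\<lambda>p. lam (fst p) (snd p)) \<longlongrightarrow> a) (at (a, 0) within ?D)"
    "((\<lambda>p. u (fst p) (snd p) $ 0) \<longlongrightarrow> 0) (at (a, 0) within ?D)"
    "((\<lambda>p. v (fst p) (snd p) $ 0) \<longlongrightarrow> - (2/3) * a^3) (at (a, 0) within ?D)"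
    "((\<lambda>p. v (fst p) (snd p) $ 1) \<longlongrightarrow> 0) (at (a, 0) within ?D)"
    "((\<lambda>p. v (fst p) (snd p) $ 2) \<longlongrightarrow> (2/3) * a^3) (at (a, 0) within ?D)"
    using tl tu[of 0] tv[of 0] tv[of 1] tv[of 2] by (simp_all add: case_prod_beta' val)
  have a3: "a^3 > 0" using a by simp
  have "\<forall>\<^sub>F p in at (a, 0) within ?D. lam (fst p) (snd p) < 2 * a \<and> a / 2 < lam (fst p) (snd p)
      \<and> v (fst p) (snd p) $ 1 < a\<^sup>2 / 12 \<and> \<bar>u (fst p) (snd p) $ 0\<bar> < 1 \<and> v (fst p) (snd p) $ 0 < - (a^3 / 3)
      \<and> v (fst p) (snd p) $ 2 > 0"
    using a a3 by (intro eventually_conj order_tendstoD[OF ts(1)] order_tendstoD[OF ts(3)]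
        order_tendstoD[OF ts(4)] order_tendstoD[OF ts(5)] order_tendstoD(2)[OF tendsto_rabs[OF ts(2)]]) auto
  then obtain d where d: "d > 0" "\<And>p. p \<in> ?D \<Longrightarrow> p \<noteq> (a, 0) \<Longrightarrow> dist p (a, 0) < d \<Longrightarrow>
      lam (fst p) (snd p) < 2 * a \<and> a / 2 < lam (fst p) (snd p)
      \<and> v (fst p) (snd p) $ 1 < a\<^sup>2 / 12 \<and> \<bar>u (fst p) (snd p) $ 0\<bar> < 1 \<and> v (fst p) (snd p) $ 0 < - (a^3 / 3)
      \<and> v (fst p) (snd p) $ 2 > 0"
    unfolding eventually_at by blast
  have "shape_one (u b t) (v b t) > 0 \<and> volume_speed (u b t) (v b t) > 0"
    if b: "\<bar>b - a\<bar> < min (d/2) (a\<^sup>2/24)" "0 < b" and t: "0 < t" "t < min (d/2) (a\<^sup>2/24)" "t < R b" for b t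
  proof -
    have near: "lam b s < 2 * a \<and> a / 2 < lam b s \<and> v b s $ 1 < a\<^sup>2 / 12 \<and> \<bar>u b s $ 0\<bar> < 1
        \<and> v b s $ 0 < - (a^3 / 3) \<and> v b s $ 2 > 0" if s: "0 < s" "s \<le> t" for s
    proof -
      have "dist (b, s) (a, 0) \<le> \<bar>b - a\<bar> + \<bar>s\<bar>"
        unfolding dist_Pair_Pair dist_real_def using sqrt_sum_squares_le_sum_abs[of "\<bar>b - a\<bar>" "\<bar>s - 0\<bar>"] by simp
      also have "\<dots> < d" using b t s by simp
      finally show ?thesis using d(2)[of "(b, s)"] b t s by simp
    qed
    note init = initial_behaviour[OF cl[OF b(2)] b(2)]
    have neg: "shape_two (u b s) (v b s) < 0" if s: "0 < s" "s \<le> t" for s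
      using init(1)[of s a] near s t by simp
    show ?thesis
      using shape_one_pos_while_shape_two_neg[OF cl[OF b(2)] b(2) t(1,3) neg] init(2)[of t a] near t by simp
  qed
  moreover have "min (d/2) (a\<^sup>2/24) > 0" using d(1) a by simp
  ultimately show ?thesis by blast
qed

section \<open>Zeros of w1 along one solution\<close>

text \<open>Otherwise \<open>shape_two\<close>, which is nondecreasing while \<open>shape_one \<ge> 0\<close>, stays \<open>\<le> 0\<close> up to \<open>T\<close>. Then
  \<open>shape_one\<close> is nondecreasing up to \<open>T\<close> and cannot come back to \<open>0\<close>.\<close>
lemma shape_two_pos_at_first_zero:
  assumes st: "nk_structure_on {0<..<R} lam u v"
    and T: "0 < T" "T < R"
    and nonneg: "\<And>t. 0 < t \<Longrightarrow> t < T \<Longrightarrow> shape_one (u t) (v t) \<ge> 0"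
    and zero: "shape_one (u T) (v T) = 0"
    and start: "\<And>e. e > 0 \<Longrightarrow> \<exists>t. 0 < t \<and> t < e \<and> shape_one (u t) (v t) > 0"
  shows "shape_two (u T) (v T) > 0"
proof (rule ccontr)
  assume neg: "\<not> ?thesis"
  have two: "shape_two (u t) (v t) \<le> 0" if t: "0 < t" "t \<le> T" for t
  proof -
    have "shape_two (u t) (v t) \<le> shape_two (u T) (v T)"
    proof (rule DERIV_nonneg_imp_nondecreasing[OF t(2)])
      fix x assume x: "t \<le> x" "x \<le> T"
      have xR: "x \<in> {0<..<R}" using x t T by auto
      have "2 * (lam x)^3 / sqrt (v x $ 1) * shape_one (u x) (v x) \<ge> 0"
        using nk_structureD(1,3)[OF st xR] nonneg[of x] zero x t
        by (cases "x = T") (auto intro!: mult_nonneg_nonneg)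
      then show "\<exists>y. ((\<lambda>s. shape_two (u s) (v s)) has_real_derivative y) (at x) \<and> y \<ge> 0"
        using shape_two_deriv[OF st xR] by blast
    qed
    then show ?thesis using neg by simp
  qed
  obtain t where t: "0 < t" "t < T" "shape_one (u t) (v t) > 0" using start[OF T(1)] by blast
  have "shape_one (u t) (v t) \<le> shape_one (u T) (v T)"
  proof (rule DERIV_nonneg_imp_nondecreasing[OF less_imp_le[OF t(2)]])
    fix x assume x: "t \<le> x" "x \<le> T"
    have xR: "x \<in> {0<..<R}" using x t T by auto
    have "- (3 * sqrt (v x $ 1) / (lam x)^3) * shape_two (u x) (v x) \<ge> 0"
      using nk_structureD(1,3)[OF st xR] two[of x] x t
      by (intro mult_nonpos_nonpos) auto
    then show "\<exists>y. ((\<lambda>s. shape_one (u s) (v s)) has_real_derivative y) (at x) \<and> y \<ge> 0"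
      using shape_one_deriv[OF st xR] by blast
  qed
  then show False using zero t(3) by simp
qed

text \<open>A zero inside \<open>(0,c)\<close> would be crossed with negative slope, by \<open>shape_two_pos_at_first_zero\<close>.\<close>
lemma shape_one_pos_if_nonneg:
  assumes st: "nk_structure_on {0<..<R} lam u v"
    and c: "c \<le> R"
    and nonneg: "\<And>t. 0 < t \<Longrightarrow> t < c \<Longrightarrow> shape_one (u t) (v t) \<ge> 0"
    and start: "\<And>e. e > 0 \<Longrightarrow> \<exists>t. 0 < t \<and> t < e \<and> shape_one (u t) (v t) > 0"
    and t: "0 < t" "t < c"
  shows "shape_one (u t) (v t) > 0"
proof (rule ccontr)
  assume "\<not> ?thesis"
  then have zero: "shape_one (u t) (v t) = 0" using nonneg[of t] t by auto
  have tR: "t \<in> {0<..<R}" using t c by auto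
  have "shape_two (u t) (v t) > 0"
    by (rule shape_two_pos_at_first_zero[OF st _ _ _ zero start]) (use t c nonneg in auto)
  then have "- (3 * sqrt (v t $ 1) / (lam t)^3) * shape_two (u t) (v t) < 0"
    using nk_structureD(1,3)[OF st tR] by (intro mult_neg_pos) auto
  from DERIV_neg_dec_right[OF shape_one_deriv[OF st tR] this]
  obtain d where "d > 0" and d: "\<And>h. 0 < h \<Longrightarrow> h < d \<Longrightarrow> shape_one (u (t + h)) (v (t + h)) < 0"
    using zero by auto
  then have "shape_one (u (t + min d (c - t) / 2)) (v (t + min d (c - t) / 2)) < 0"
    using t by (intro d) auto
  moreover have "shape_one (u (t + min d (c - t) / 2)) (v (t + min d (c - t) / 2)) \<ge> 0"
    using t \<open>d > 0\<close> by (intro nonneg) (auto simp: min_def field_simps)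
  ultimately show False by simp
qed


section \<open>Deforming the parameter\<close>

text \<open>The lifetime \<open>R b\<close> may depend on \<open>b\<close> in any way, even discontinuously. The statements below therefore speak only of those
  \<open>b\<close> near \<open>a\<close> for which the time in question is still below \<open>R b\<close>.\<close>
lemma negativity_stable:
  fixes f :: "real \<Rightarrow> real \<Rightarrow> real"
  assumes cont: "continuous_on {(b, t). 0 < b \<and> 0 < t \<and> t < R b} (\<lambda>(b, t). f b t)"
    and a: "0 < a" "0 < t" "t < R a" and neg: "f a t < 0"
  shows "\<exists>e>0. \<forall>b. \<bar>b - a\<bar> < e \<longrightarrow> 0 < b \<longrightarrow> t < R b \<longrightarrow> f b t < 0"
proof -
  let ?D = "{(b, t). 0 < b \<and> 0 < t \<and> t < R b}"
  have "\<forall>\<^sub>F p in at (a, t) within ?D. (\<lambda>(b, t). f b t) p < 0"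
    using cont a neg unfolding continuous_on_def by (intro order_tendstoD(2)[of _ "f a t"]) auto
  then obtain e where e: "e > 0"
    "\<And>p. p \<in> ?D \<Longrightarrow> p \<noteq> (a, t) \<Longrightarrow> dist p (a, t) < e \<Longrightarrow> (\<lambda>(b, t). f b t) p < 0"
    unfolding eventually_at by blast
  have "f b t < 0" if "\<bar>b - a\<bar> < e" "0 < b" "t < R b" for b
  proof (cases "b = a")
    case False
    have "dist (b, t) (a, t) < e" using that by (simp add: dist_Pair_Pair dist_real_def)
    then show ?thesis using e(2)[of "(b, t)"] that a False by auto
  qed (use neg in simp)
  then show ?thesis using e(1) by blast
qed

text \<open>This is the tube lemma on \<open>(0, c]\<close>; the assumption \<open>start\<close> makes up for the missing endpoint \<open>0\<close>.\<close>
lemma positivity_stable: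
  fixes f :: "real \<Rightarrow> real \<Rightarrow> real"
  assumes cont: "continuous_on {(b, t). 0 < b \<and> 0 < t \<and> t < R b} (\<lambda>(b, t). f b t)"
    and start: "\<exists>e>0. \<forall>b t. \<bar>b - a\<bar> < e \<longrightarrow> 0 < b \<longrightarrow> 0 < t \<longrightarrow> t < e \<longrightarrow> t < R b \<longrightarrow> f b t > 0"
    and a: "0 < a" "c < R a" and pos: "\<And>t. 0 < t \<Longrightarrow> t \<le> c \<Longrightarrow> f a t > 0"
  shows "\<exists>e>0. \<forall>b t. \<bar>b - a\<bar> < e \<longrightarrow> 0 < b \<longrightarrow> 0 < t \<longrightarrow> t \<le> c \<longrightarrow> t < R b \<longrightarrow> f b t > 0"
proof (rule ccontr)
  let ?D = "{(b, t). 0 < b \<and> 0 < t \<and> t < R b}"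
  assume "\<not> ?thesis"
  then have "\<forall>n. \<exists>b t. \<bar>b - a\<bar> < 1 / real (Suc n) \<and> 0 < b \<and> 0 < t \<and> t \<le> c \<and> t < R b \<and> f b t \<le> 0"
    by (smt (verit) of_nat_0_less_iff zero_less_Suc divide_pos_pos)
  then obtain B S where BS: "\<And>n. \<bar>B n - a\<bar> < 1 / real (Suc n)"
     "\<And>n. 0 < B n \<and> 0 < S n \<and> S n \<le> c \<and> S n < R (B n)" "\<And>n. f (B n) (S n) \<le> 0"
    by metis
  have "(\<lambda>n. B n - a) \<longlonglongrightarrow> 0"
    by (rule Lim_null_comparison[OF _ LIMSEQ_inverse_real_of_nat])
      (use BS(1) in \<open>auto simp: inverse_eq_divide intro!: always_eventually less_imp_le\<close>)
  then have B: "B \<longlonglongrightarrow> a" by (simp add: LIM_zero_iff)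
  have "\<forall>n. S n \<in> {0..c}" using BS(2) by (auto intro: less_imp_le)
  then obtain s r where s: "s \<in> {0..c}" and r: "strict_mono r" and lim: "(S \<circ> r) \<longlonglongrightarrow> s"
    using compact_Icc[of 0 c] unfolding compact_def by metis
  have Br: "(\<lambda>n. B (r n)) \<longlonglongrightarrow> a" using LIMSEQ_subseq_LIMSEQ[OF B r] by (simp add: o_def)
  have Sr: "(\<lambda>n. S (r n)) \<longlonglongrightarrow> s" using lim by (simp add: o_def)
  show False
  proof (cases "s = 0")
    case True
    obtain e where e: "e > 0"
      "\<And>b t. \<bar>b - a\<bar> < e \<Longrightarrow> 0 < b \<Longrightarrow> 0 < t \<Longrightarrow> t < e \<Longrightarrow> t < R b \<Longrightarrow> f b t > 0"
      using start by blast
    have "\<forall>\<^sub>F n in sequentially. S (r n) < e" using order_tendstoD(2)[OF Sr] True e(1) by simp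
    moreover have "\<forall>\<^sub>F n in sequentially. \<bar>B (r n) - a\<bar> < e"
      using tendstoD[OF Br e(1)] by (simp add: dist_real_def)
    ultimately have "\<forall>\<^sub>F n in sequentially. False"
    proof eventually_elim
      case (elim n)
      then have "f (B (r n)) (S (r n)) > 0" using e(2) BS(2) by blast
      then show ?case using BS(3)[of "r n"] by simp
    qed
    then show False by simp
  next
    case False
    have mem: "(a, s) \<in> ?D" using s False a by auto
    have "(\<lambda>n. (\<lambda>(b, t). f b t) (B (r n), S (r n))) \<longlonglongrightarrow> (\<lambda>(b, t). f b t) (a, s)"
      by (rule continuous_on_tendsto_compose[OF cont tendsto_Pair[OF Br Sr] mem])
        (use BS(2) in auto)
    then have "f a s \<le> 0" using BS(3) by (intro LIMSEQ_le_const2[of "\<lambda>n. f (B (r n)) (S (r n))"]) auto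
    then show False using pos[of s] s False by auto
  qed
qed

lemma sign_around_zero:
  fixes g :: "real \<Rightarrow> real"
  assumes cont: "\<And>t. 0 < t \<Longrightarrow> t < R \<Longrightarrow> isCont g t"
    and T: "0 < T" "T < R" and zero: "\<And>t. 0 < t \<Longrightarrow> t < R \<Longrightarrow> g t = 0 \<longleftrightarrow> t = T"
    and start: "\<exists>e>0. \<forall>t. 0 < t \<longrightarrow> t < e \<longrightarrow> t < R \<longrightarrow> g t > 0"
    and D: "D < 0" "(g has_real_derivative D) (at T)"
  shows "\<And>t. 0 < t \<Longrightarrow> t < T \<Longrightarrow> g t > 0" "\<And>t. T < t \<Longrightarrow> t < R \<Longrightarrow> g t < 0"
proof -
  fix t assume t: "0 < t" "t < T"
  obtain e where e: "e > 0" "\<And>t. 0 < t \<Longrightarrow> t < e \<Longrightarrow> t < R \<Longrightarrow> g t > 0" using start by blast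
  define s where "s = min (e/2) t"
  have s: "0 < s" "s \<le> t" "g s > 0" using e t T unfolding s_def by auto
  show "g t > 0"
  proof (rule ccontr)
    assume "\<not> g t > 0"
    then obtain x where "s \<le> x" "x \<le> t" "g x = 0"
      using IVT2[of g t 0 s] s t T cont by auto
    then show False using zero[of x] s t T by auto
  qed
next
  fix t assume t: "T < t" "t < R"
  have T0: "g T = 0" using zero T by blast
  obtain d where d: "d > 0" "\<And>h. 0 < h \<Longrightarrow> h < d \<Longrightarrow> g (T + h) < g T"
    using DERIV_neg_dec_right[OF D(2,1)] by blast
  define s where "s = min (T + d/2) t"
  have s: "T < s" "s \<le> t" "g s < 0"
    using d(1) d(2)[of "s - T"] T0 t unfolding s_def by auto
  show "g t < 0"
  proof (rule ccontr)
    assume "\<not> g t < 0"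
    then obtain x where "s \<le> x" "x \<le> t" "g x = 0"
      using IVT[of g s 0 t] s t T cont by auto
    then show False using zero[of x] s t T by auto
  qed
qed

text \<open>Let \<open>P b\<close> say that \<open>f b\<close> is positive on \<open>(0, T b)\<close>. The sign change of \<open>g b\<close> at \<open>T b\<close> makes \<open>T\<close> continuous.
  If \<open>P\<close> fails at some \<open>b\<close>, then by \<open>f_nonneg\<close> the function \<open>f b\<close> is strictly negative somewhere on \<open>(0, T b)\<close>, so \<open>P\<close>
  fails nearby. If \<open>P\<close> holds at some \<open>b\<close> in \<open>(a, c]\<close>, then \<open>f_end\<close> extends positivity slightly beyond \<open>T b\<close>, so \<open>P\<close> holds nearby.
  Hence \<open>P\<close> passes from \<open>c\<close> to the connected set \<open>(a, c]\<close>, and from there to its limit point \<open>a\<close>.\<close>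
lemma positivity_propagates:
  fixes f g :: "real \<Rightarrow> real \<Rightarrow> real" and R T :: "real \<Rightarrow> real"
  assumes f_cont: "continuous_on {(b, t). 0 < b \<and> 0 < t \<and> t < R b} (\<lambda>(b, t). f b t)"
    and g_cont: "continuous_on {(b, t). 0 < b \<and> 0 < t \<and> t < R b} (\<lambda>(b, t). g b t)"
    and f_start: "\<And>a. 0 < a \<Longrightarrow> \<exists>e>0. \<forall>b t. \<bar>b - a\<bar> < e \<longrightarrow> 0 < b \<longrightarrow> 0 < t \<longrightarrow> t < e \<longrightarrow> t < R b \<longrightarrow> f b t > 0"
    and g_start: "\<And>a. 0 < a \<Longrightarrow> \<exists>e>0. \<forall>b t. \<bar>b - a\<bar> < e \<longrightarrow> 0 < b \<longrightarrow> 0 < t \<longrightarrow> t < e \<longrightarrow> t < R b \<longrightarrow> g b t > 0"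
    and T: "\<And>b. 0 < b \<Longrightarrow> 0 < T b \<and> T b < R b"
    and g_zero: "\<And>b. 0 < b \<Longrightarrow> g b (T b) = 0"
    and g_pos: "\<And>b t. 0 < b \<Longrightarrow> 0 < t \<Longrightarrow> t < T b \<Longrightarrow> g b t > 0"
    and g_neg: "\<And>b t. 0 < b \<Longrightarrow> T b < t \<Longrightarrow> t < R b \<Longrightarrow> g b t < 0"
    and f_nonneg: "\<And>b t. 0 < b \<Longrightarrow> (\<And>t. 0 < t \<Longrightarrow> t < T b \<Longrightarrow> f b t \<ge> 0) \<Longrightarrow> 0 < t \<Longrightarrow> t < T b \<Longrightarrow> f b t > 0"
    and a: "0 < a" "a < c"
    and f_end: "\<And>b. a < b \<Longrightarrow> b \<le> c \<Longrightarrow> f b (T b) \<noteq> 0"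
    and f_c: "\<And>t. 0 < t \<Longrightarrow> t < T c \<Longrightarrow> f c t > 0"
    and t: "0 < t" "t < T a"
  shows "f a t > 0"
proof -
  have T_upper: "\<exists>e>0. \<forall>b. \<bar>b - d\<bar> < e \<longrightarrow> 0 < b \<longrightarrow> T b < s" if d: "0 < d" "T d < s" "s < R d" for d s
  proof -
    have "0 < s" using T[OF d(1)] d by linarith
    then obtain e where e: "e > 0" "\<And>b. \<bar>b - d\<bar> < e \<Longrightarrow> 0 < b \<Longrightarrow> s < R b \<Longrightarrow> g b s < 0"
      using negativity_stable[OF g_cont d(1) _ d(3) g_neg[OF d]] by blast
    have "T b < s" if b: "\<bar>b - d\<bar> < e" "0 < b" for b
    proof (rule ccontr)
      assume s: "\<not> T b < s"
      then have "g b s < 0" using e(2) b T[OF b(2)] by auto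
      moreover have "g b s \<ge> 0"
        using g_pos[OF b(2) \<open>0 < s\<close>] g_zero[OF b(2)] s by (cases "s = T b") auto
      ultimately show False by simp
    qed
    then show ?thesis using e(1) by blast
  qed
  have T_lower: "\<exists>e>0. \<forall>b. \<bar>b - d\<bar> < e \<longrightarrow> 0 < b \<longrightarrow> s < T b" if d: "0 < d" "s < T d" for d s
  proof -
    have "\<exists>e>0. \<forall>b t. \<bar>b - d\<bar> < e \<longrightarrow> 0 < b \<longrightarrow> 0 < t \<longrightarrow> t \<le> s \<longrightarrow> t < R b \<longrightarrow> g b t > 0"
      by (rule positivity_stable[OF g_cont g_start[OF d(1)] d(1)])
        (use d T[OF d(1)] g_pos in auto)
    then obtain e where e: "e > 0" "\<And>b t. \<bar>b - d\<bar> < e \<Longrightarrow> 0 < b \<Longrightarrow> 0 < t \<Longrightarrow> t \<le> s \<Longrightarrow> t < R b \<Longrightarrow> g b t > 0"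
      by blast
    have "s < T b" if "\<bar>b - d\<bar> < e" "0 < b" for b
      using e(2)[of b "T b"] that T[of b] g_zero[of b] by fastforce
    then show ?thesis using e(1) by blast
  qed
  define P where "P b \<longleftrightarrow> (\<forall>t. 0 < t \<longrightarrow> t < T b \<longrightarrow> f b t > 0)" for b
  have not_P_stable: "\<exists>e>0. \<forall>b. \<bar>b - d\<bar> < e \<longrightarrow> 0 < b \<longrightarrow> \<not> P b" if d: "0 < d" "\<not> P d" for d
  proof -
    obtain s where s: "0 < s" "s < T d" "f d s < 0"
      using d f_nonneg unfolding P_def by (meson not_less)
    have "s < R d" using s T[OF d(1)] by linarith
    obtain e1 where e1: "e1 > 0" "\<And>b. \<bar>b - d\<bar> < e1 \<Longrightarrow> 0 < b \<Longrightarrow> s < R b \<Longrightarrow> f b s < 0"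
      using negativity_stable[OF f_cont d(1) s(1) \<open>s < R d\<close> s(3)] by blast
    obtain e2 where e2: "e2 > 0" "\<And>b. \<bar>b - d\<bar> < e2 \<Longrightarrow> 0 < b \<Longrightarrow> s < T b"
      using T_lower[OF d(1) s(2)] by blast
    have "\<not> P b" if b: "\<bar>b - d\<bar> < min e1 e2" "0 < b" for b
    proof -
      have "s < T b" using e2 b by simp
      then have "f b s < 0" using e1(2)[of b] b T[OF b(2)] by simp
      then show ?thesis unfolding P_def using s(1) \<open>s < T b\<close> by fastforce
    qed
    then show ?thesis using e1(1) e2(1) by (intro exI[of _ "min e1 e2"]) auto
  qed
  have P_stable: "\<exists>e>0. \<forall>b. \<bar>b - d\<bar> < e \<longrightarrow> 0 < b \<longrightarrow> P b" if d: "a < d" "d \<le> c" "P d" for d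
  proof -
    have d0: "0 < d" using a d by simp
    note Td = T[OF d0]
    have pos: "f d s > 0" if "0 < s" "s < T d" for s using that d(3) unfolding P_def by blast
    have end_cont: "isCont (f d) (T d)"
    proof -
      have "continuous_on {0<..<R d} ((\<lambda>(b, t). f b t) \<circ> (\<lambda>t. (d, t)))"
        by (intro continuous_on_compose continuous_intros continuous_on_subset[OF f_cont]) (use d0 in auto)
      then have "continuous_on {0<..<R d} (f d)" by (simp add: o_def)
      then show ?thesis using Td by (simp add: continuous_on_eq_continuous_at)
    qed
    have "f d (T d) \<ge> 0"
    proof (rule tendsto_lowerbound)
      show "(f d \<longlongrightarrow> f d (T d)) (at_left (T d))"
        using end_cont unfolding isCont_def by (rule filterlim_mono[OF _ order_refl at_le]) simp
      show "\<forall>\<^sub>F s in at_left (T d). 0 \<le> f d s"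
        unfolding eventually_at_left_field using pos Td by (intro exI[of _ 0]) (auto intro: less_imp_le)
    qed simp
    then have "f d (T d) > 0" using f_end[OF d(1,2)] by simp
    then have "\<forall>\<^sub>F s in at (T d). f d s > 0" 
      using end_cont unfolding isCont_def by (rule order_tendstoD(1)[rotated])
    then obtain h where h: "h > 0" "\<And>s. s \<noteq> T d \<Longrightarrow> dist s (T d) < h \<Longrightarrow> f d s > 0"
      unfolding eventually_at by auto
    obtain s where s: "T d < s" "s < R d" "s < T d + h"
      using dense[of "T d" "min (R d) (T d + h)"] h(1) Td by auto
    have "\<exists>e>0. \<forall>b t. \<bar>b - d\<bar> < e \<longrightarrow> 0 < b \<longrightarrow> 0 < t \<longrightarrow> t \<le> s \<longrightarrow> t < R b \<longrightarrow> f b t > 0"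
    proof (rule positivity_stable[OF f_cont f_start[OF d0] d0 s(2)])
      fix x assume x: "0 < x" "x \<le> s"
      consider "x < T d" | "x = T d" | "T d < x" by linarith
      then show "f d x > 0"
        by cases (use pos x \<open>f d (T d) > 0\<close> h(2)[of x] s in \<open>auto simp: dist_real_def\<close>)
    qed
    then obtain e1 where e1: "e1 > 0" "\<And>b t. \<bar>b - d\<bar> < e1 \<Longrightarrow> 0 < b \<Longrightarrow> 0 < t \<Longrightarrow> t \<le> s \<Longrightarrow> t < R b \<Longrightarrow> f b t > 0"
      by blast
    obtain e2 where e2: "e2 > 0" "\<And>b. \<bar>b - d\<bar> < e2 \<Longrightarrow> 0 < b \<Longrightarrow> T b < s"
      using T_upper[OF d0 s(1,2)] by blast
    have "P b" if b: "\<bar>b - d\<bar> < min e1 e2" "0 < b" for b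
      unfolding P_def using e1(2)[of b] e2(2)[of b] b T[OF b(2)] by fastforce
    then show ?thesis using e1(1) e2(1) by (intro exI[of _ "min e1 e2"]) auto
  qed
  have P_right: "P b" if b: "a < b" "b \<le> c" for b
  proof (rule connected_induction_simple[of "{a<..c}" c b P])
    show "P c" using f_c unfolding P_def by blast
    fix d assume d: "d \<in> {a<..c}"
    have "\<exists>e>0. \<forall>b. \<bar>b - d\<bar> < e \<longrightarrow> 0 < b \<longrightarrow> (P b \<longleftrightarrow> P d)"
      using P_stable[of d] not_P_stable[of d] d a by (cases "P d") auto
    then obtain e where e: "e > 0" "\<And>b. \<bar>b - d\<bar> < e \<Longrightarrow> 0 < b \<Longrightarrow> P b \<longleftrightarrow> P d" by blast
    show "\<exists>U. openin (top_of_set {a<..c}) U \<and> d \<in> U \<and> (\<forall>x\<in>U. \<forall>y\<in>U. P x \<longrightarrow> P y)"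
    proof (intro exI conjI ballI)
      show "openin (top_of_set {a<..c}) ({a<..c} \<inter> ball d e)" by (simp add: openin_open_Int)
      show "d \<in> {a<..c} \<inter> ball d e" using d e(1) by simp
      fix x y assume "x \<in> {a<..c} \<inter> ball d e" "y \<in> {a<..c} \<inter> ball d e"
      then have "P x \<longleftrightarrow> P d" "P y \<longleftrightarrow> P d"
        using a by (auto intro!: e(2) simp: dist_real_def)
      then show "P x \<longrightarrow> P y" by blast
    qed
  qed (use b a in auto)
  have "P a"
  proof (rule ccontr)
    assume "\<not> P a"
    then obtain e where e: "e > 0" "\<And>b. \<bar>b - a\<bar> < e \<Longrightarrow> 0 < b \<Longrightarrow> \<not> P b"
      using not_P_stable[OF a(1)] by blast
    have "\<not> P (a + min (e/2) (c - a))" using e(1) a by (intro e(2)) auto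
    moreover have "P (a + min (e/2) (c - a))" using e(1) a by (intro P_right) auto
    ultimately show False by blast
  qed
  then show ?thesis using t unfolding P_def by blast
qed

section \<open>The homogeneous solution\<close>

lemma trig_deriv:
  "((\<lambda>t. p * sin (c * t) + q * cos (c * t) + r) has_real_derivative
      (- q * c) * sin (c * t) + (p * c) * cos (c * t) + 0) (at t)" for c p q r t :: real
  by (rule derivative_eq_intros refl | simp)+

lemma smooth_real_on_trig:
  "smooth_real_on S (\<lambda>t. p * sin (c * t) + q * cos (c * t) + r)"
proof -
  have form: "\<exists>p' q' r'. (deriv ^^ n) (\<lambda>t. p * sin (c * t) + q * cos (c * t) + r)
      = (\<lambda>t. p' * sin (c * t) + q' * cos (c * t) + r')" for n
  proof (induction n)
    case (Suc n)
    then obtain p' q' r' where "(deriv ^^ n) (\<lambda>t. p * sin (c * t) + q * cos (c * t) + r)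
      = (\<lambda>t. p' * sin (c * t) + q' * cos (c * t) + r')" by blast
    moreover have "deriv (\<lambda>t. p' * sin (c * t) + q' * cos (c * t) + r')
      = (\<lambda>t. (- q' * c) * sin (c * t) + (p' * c) * cos (c * t) + 0)"
      by (rule ext, rule DERIV_imp_deriv, rule trig_deriv)
    ultimately have "(deriv ^^ Suc n) (\<lambda>t. p * sin (c * t) + q * cos (c * t) + r)
      = (\<lambda>t. (- q' * c) * sin (c * t) + (p' * c) * cos (c * t) + 0)"
      unfolding funpow.simps o_apply by (simp only:)
    then show ?case by blast
  qed auto
  show ?thesis
    unfolding smooth_real_on_def
  proof (intro allI ballI)
    fix n t
    obtain p' q' r' where e: "(deriv ^^ n) (\<lambda>t. p * sin (c * t) + q * cos (c * t) + r)
      = (\<lambda>t. p' * sin (c * t) + q' * cos (c * t) + r')" using form by blast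
    show "(deriv ^^ n) (\<lambda>t. p * sin (c * t) + q * cos (c * t) + r) differentiable at t"
      unfolding e real_differentiable_def by (rule exI, rule trig_deriv)
  qed
qed

text \<open>With \<open>\<lambda> = 1\<close> the system becomes linear with constant coefficients, of frequency \<open>2\<surd>3\<close> in the components \<open>0\<close> and \<open>1\<close> and
  of frequency \<open>\<surd>3\<close> in the component \<open>2\<close>. These are the solutions with the initial values that close smoothly for \<open>b = 1\<close>.\<close>
definition homogeneous_u :: "real \<Rightarrow> real^3" where
  "homogeneous_u t = (\<chi> i. if i = 2 then - (2 / sqrt 3) * sin (sqrt 3 * t) else 1 / sqrt 3 * sin (2 * sqrt 3 * t))"

definition homogeneous_v :: "real \<Rightarrow> real^3" where
  "homogeneous_v t = (\<chi> i. if i = 0 then - (2/3) * cos (2 * sqrt 3 * t)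
     else if i = 1 then 2/3 - 2/3 * cos (2 * sqrt 3 * t) else 2/3 * cos (sqrt 3 * t))"

lemma homogeneous_components:
  "homogeneous_u t $ 0 = 1 / sqrt 3 * sin (2 * sqrt 3 * t)"
  "homogeneous_u t $ 1 = 1 / sqrt 3 * sin (2 * sqrt 3 * t)"
  "homogeneous_u t $ 2 = - (2 / sqrt 3) * sin (sqrt 3 * t)"
  "homogeneous_v t $ 0 = - (2/3) * cos (2 * sqrt 3 * t)"
  "homogeneous_v t $ 1 = 2/3 - 2/3 * cos (2 * sqrt 3 * t)"
  "homogeneous_v t $ 2 = 2/3 * cos (sqrt 3 * t)"
  by (simp_all add: homogeneous_u_def homogeneous_v_def)

lemma homogeneous_trig_form:
    "(\<lambda>t. homogeneous_u t $ 0) = (\<lambda>t. 1 / sqrt 3 * sin (2 * sqrt 3 * t) + 0 * cos (2 * sqrt 3 * t) + 0)"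
    "(\<lambda>t. homogeneous_u t $ 1) = (\<lambda>t. 1 / sqrt 3 * sin (2 * sqrt 3 * t) + 0 * cos (2 * sqrt 3 * t) + 0)"
    "(\<lambda>t. homogeneous_u t $ 2) = (\<lambda>t. - (2 / sqrt 3) * sin (sqrt 3 * t) + 0 * cos (sqrt 3 * t) + 0)"
    "(\<lambda>t. homogeneous_v t $ 0) = (\<lambda>t. 0 * sin (2 * sqrt 3 * t) + (- (2/3)) * cos (2 * sqrt 3 * t) + 0)"
    "(\<lambda>t. homogeneous_v t $ 1) = (\<lambda>t. 0 * sin (2 * sqrt 3 * t) + (- (2/3)) * cos (2 * sqrt 3 * t) + 2/3)"
    "(\<lambda>t. homogeneous_v t $ 2) = (\<lambda>t. 0 * sin (sqrt 3 * t) + 2/3 * cos (sqrt 3 * t) + 0)"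
  by (simp_all add: homogeneous_components fun_eq_iff)

lemma homogeneous_double_angle:
  "sin (2 * sqrt 3 * t) = 2 * sin (sqrt 3 * t) * cos (sqrt 3 * t)"
  "cos (2 * sqrt 3 * t) = 1 - 2 * (sin (sqrt 3 * t))\<^sup>2"
  using sin_double[of "sqrt 3 * t"] cos_double_sin[of "sqrt 3 * t"] by (simp_all add: mult_ac)

lemma homogeneous_sin_pos:
  assumes "0 < t" "t < pi / sqrt 3"
  shows "sin (sqrt 3 * t) > 0"
  using assms by (intro sin_gt_zero) (simp_all add: field_simps)

lemma homogeneous_smooth: "smooth_triple_on S (\<lambda>t. 1) homogeneous_u homogeneous_v"
proof -
  have one: "(\<lambda>t::real. 1::real) = (\<lambda>t. 0 * sin (0 * t) + 0 * cos (0 * t) + 1)" by simp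
  have sm: "smooth_real_on S (\<lambda>t. 1)"
    "smooth_real_on S (\<lambda>t. homogeneous_u t $ 0)" "smooth_real_on S (\<lambda>t. homogeneous_u t $ 1)"
    "smooth_real_on S (\<lambda>t. homogeneous_u t $ 2)" "smooth_real_on S (\<lambda>t. homogeneous_v t $ 0)"
    "smooth_real_on S (\<lambda>t. homogeneous_v t $ 1)" "smooth_real_on S (\<lambda>t. homogeneous_v t $ 2)"
    unfolding homogeneous_trig_form by (subst one, rule smooth_real_on_trig) (rule smooth_real_on_trig)+
  have "smooth_real_on S (\<lambda>t. homogeneous_u t $ i) \<and> smooth_real_on S (\<lambda>t. homogeneous_v t $ i)" for i
  proof -
    consider "i = 0" | "i = 1" | "i = 2" using exhaust_3[of i] by auto
    then show ?thesis by cases (simp_all only: sm)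
  qed
  then show ?thesis unfolding smooth_triple_on_def using sm(1) by blast
qed

lemma homogeneous_derivs:
  "deriv (\<lambda>t. homogeneous_u t $ 0) t = 2 * cos (2 * sqrt 3 * t)"
  "deriv (\<lambda>t. homogeneous_u t $ 1) t = 2 * cos (2 * sqrt 3 * t)"
  "deriv (\<lambda>t. homogeneous_u t $ 2) t = - 2 * cos (sqrt 3 * t)"
  "deriv (\<lambda>t. homogeneous_v t $ 0) t = 4 / sqrt 3 * sin (2 * sqrt 3 * t)"
  "deriv (\<lambda>t. homogeneous_v t $ 1) t = 4 / sqrt 3 * sin (2 * sqrt 3 * t)"
  "deriv (\<lambda>t. homogeneous_v t $ 2) t = - (2 / sqrt 3) * sin (sqrt 3 * t)"
proof -
  have k: "2 / 3 * sqrt 3 = 2 / sqrt 3" "4 / 3 * sqrt 3 = 4 / sqrt 3" by (simp_all add: field_simps)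
  note d = DERIV_imp_deriv[OF trig_deriv]
  show "deriv (\<lambda>t. homogeneous_u t $ 0) t = 2 * cos (2 * sqrt 3 * t)"
    "deriv (\<lambda>t. homogeneous_u t $ 1) t = 2 * cos (2 * sqrt 3 * t)"
    "deriv (\<lambda>t. homogeneous_u t $ 2) t = - 2 * cos (sqrt 3 * t)"
    "deriv (\<lambda>t. homogeneous_v t $ 0) t = 4 / sqrt 3 * sin (2 * sqrt 3 * t)"
    "deriv (\<lambda>t. homogeneous_v t $ 1) t = 4 / sqrt 3 * sin (2 * sqrt 3 * t)"
    "deriv (\<lambda>t. homogeneous_v t $ 2) t = - (2 / sqrt 3) * sin (sqrt 3 * t)"
    unfolding homogeneous_trig_form d k[symmetric] by simp_all
qed

lemma homogeneous_nk_structure: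
  "nk_structure_on {0<..<pi / sqrt 3} (\<lambda>t. 1) homogeneous_u homogeneous_v"
  unfolding nk_structure_on_def
proof (intro conjI ballI homogeneous_smooth)
  fix t assume t: "t \<in> {0<..<pi / sqrt 3}"
  define x y where xy: "x = sin (sqrt 3 * t)" "y = cos (sqrt 3 * t)"
  define k where "k = 1 / sqrt 3"
  have k: "k\<^sup>2 = 1/3" "k > 0" by (simp_all add: k_def power_divide)
  have x: "x > 0" using homogeneous_sin_pos t by (simp add: xy)
  have s: "x\<^sup>2 + y\<^sup>2 = 1" by (simp add: xy)
  have comp: "homogeneous_u t $ 0 = k * (2*x*y)" "homogeneous_u t $ 1 = k * (2*x*y)"
     "homogeneous_u t $ 2 = - (2 * k) * x" "homogeneous_v t $ 0 = - (2/3) * (1 - 2 * x\<^sup>2)"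
     "homogeneous_v t $ 1 = 4/3 * x\<^sup>2" "homogeneous_v t $ 2 = 2/3 * y"
    by (simp_all add: homogeneous_components homogeneous_double_angle xy k_def right_diff_distrib)
  have uu: "mink (homogeneous_u t) (homogeneous_u t) = 4/3 * x\<^sup>2"
    unfolding mink_def comp using k(1) by (simp add: power2_eq_square)
  show "(0::real) < 1" by simp
  show "mink (homogeneous_u t) (homogeneous_u t) > 0" unfolding uu using x by simp
  show "homogeneous_u t $ 2 < 0" unfolding comp using x k by simp
  have "k * x * (4/3 * y\<^sup>2 + 8/3 * x\<^sup>2) > 0" using x k by (intro mult_pos_pos add_nonneg_pos) auto
  then show "homogeneous_u t $ 1 * homogeneous_v t $ 2 - homogeneous_u t $ 2 * homogeneous_v t $ 1 > 0"
    unfolding comp by (simp add: algebra_simps power2_eq_square)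
  show "1 * deriv (\<lambda>s. homogeneous_u s $ 0) t + 3 * homogeneous_v t $ 0 = 0"
    "1 * deriv (\<lambda>s. homogeneous_u s $ 1) t + 3 * homogeneous_v t $ 1 = 2 * 1\<^sup>2"
    "1 * deriv (\<lambda>s. homogeneous_u s $ 2) t + 3 * homogeneous_v t $ 2 = 0"
    "deriv (\<lambda>s. homogeneous_v s $ 0) t = 4 * 1 * homogeneous_u t $ 0"
    "deriv (\<lambda>s. homogeneous_v s $ 1) t = 4 * 1 * homogeneous_u t $ 1"
    "deriv (\<lambda>s. homogeneous_v s $ 2) t = 4 * 1 * homogeneous_u t $ 2 - 3 * (homogeneous_u t $ 2 / 1)"
    unfolding homogeneous_derivs unfolding homogeneous_components by simp_all
  show "mink (homogeneous_u t) (homogeneous_v t) = 0"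
    unfolding mink_def comp by (simp add: algebra_simps power2_eq_square)
  show "1\<^sup>2 * mink (homogeneous_u t) (homogeneous_u t) = (homogeneous_u t $ 2)\<^sup>2"
    unfolding uu comp by (simp add: power_mult_distrib k)
  have vv: "mink (homogeneous_v t) (homogeneous_v t) = 4/3 * x\<^sup>2"
    unfolding mink_def comp using s by algebra
  show "1\<^sup>2 * mink (homogeneous_u t) (homogeneous_u t) = mink (homogeneous_v t) (homogeneous_v t)"
    unfolding uu vv by simp
  show "homogeneous_v t $ 1 = mink (homogeneous_u t) (homogeneous_u t)" unfolding uu comp by simp
qed

lemma homogeneous_closing:
  "nk_closing_S3 1 (pi / sqrt 3) (\<lambda>t. 1) homogeneous_u homogeneous_v"
  unfolding nk_closing_S3_def
proof (intro conjI ballI homogeneous_smooth homogeneous_nk_structure)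
  show "0 < pi / sqrt 3" by simp
  show "homogeneous_u (- t) = - homogeneous_u t" "homogeneous_v (- t) = homogeneous_v t" for t
    by (simp_all add: homogeneous_u_def homogeneous_v_def vec_eq_iff)
  have sin: "(\<lambda>t. a * (sin (c * t) - c * t)) \<in> O[at_right 0](\<lambda>t. t ^ 3)"
    and cos: "(\<lambda>t. a * (cos (c * t) - 1)) \<in> O[at_right 0](\<lambda>t. t\<^sup>2)"
    if c: "c > 0" and a: "a \<noteq> 0" for a c :: real
  proof -
    have "(\<lambda>t. sin (c * t) - c * t) \<in> O[at_right 0](\<lambda>t. t ^ 3)" using c by real_asymp
    then show "(\<lambda>t. a * (sin (c * t) - c * t)) \<in> O[at_right 0](\<lambda>t. t ^ 3)"
      unfolding landau_o.big.cmult_in_iff[OF a] .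
    have "(\<lambda>t. cos (c * t) - 1) \<in> O[at_right 0](\<lambda>t. t\<^sup>2)" using c by real_asymp
    then show "(\<lambda>t. a * (cos (c * t) - 1)) \<in> O[at_right 0](\<lambda>t. t\<^sup>2)"
      unfolding landau_o.big.cmult_in_iff[OF a] .
  qed
  have u: "homogeneous_u t $ 0 - 2 * 1\<^sup>2 * t = 1 / sqrt 3 * (sin (2 * sqrt 3 * t) - 2 * sqrt 3 * t)"
    "homogeneous_u t $ 1 - 2 * 1 * t = 1 / sqrt 3 * (sin (2 * sqrt 3 * t) - 2 * sqrt 3 * t)"
    "homogeneous_u t $ 2 - - 2 * 1\<^sup>2 * t = - (2 / sqrt 3) * (sin (sqrt 3 * t) - sqrt 3 * t)" for t
    by (simp_all add: homogeneous_components field_simps)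
  have v: "homogeneous_v t $ 0 - - (2 / 3) * 1 ^ 3 = - (2/3) * (cos (2 * sqrt 3 * t) - 1)"
    "homogeneous_v t $ 1 = - (2/3) * (cos (2 * sqrt 3 * t) - 1)"
    "homogeneous_v t $ 2 - 2 / 3 * 1 ^ 3 = 2/3 * (cos (sqrt 3 * t) - 1)" for t
    by (simp_all add: homogeneous_components field_simps)
  show "(\<lambda>t. homogeneous_u t $ 0 - 2 * 1\<^sup>2 * t) \<in> O[at_right 0](\<lambda>t. t ^ 3)"
    "(\<lambda>t. homogeneous_u t $ 1 - 2 * 1 * t) \<in> O[at_right 0](\<lambda>t. t ^ 3)"
    "(\<lambda>t. homogeneous_u t $ 2 - - 2 * 1\<^sup>2 * t) \<in> O[at_right 0](\<lambda>t. t ^ 3)"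
    unfolding u by (rule sin; simp)+
  show "(\<lambda>t. homogeneous_v t $ 0 - - (2 / 3) * 1 ^ 3) \<in> O[at_right 0](\<lambda>t. t\<^sup>2)"
    "(\<lambda>t. homogeneous_v t $ 1) \<in> O[at_right 0](\<lambda>t. t\<^sup>2)"
    "(\<lambda>t. homogeneous_v t $ 2 - 2 / 3 * 1 ^ 3) \<in> O[at_right 0](\<lambda>t. t\<^sup>2)"
    unfolding v by (rule cos; simp)+
  show "(\<lambda>t::real. 1 - 1 :: real) \<in> O[at_right 0](\<lambda>t. t\<^sup>2)" by simp
qed simp_all

lemma homogeneous_shape_one_pos:
  assumes "0 < t" "t < pi / sqrt 3"
  shows "shape_one (homogeneous_u t) (homogeneous_v t) > 0"
proof -
  define x y where xy: "x = sin (sqrt 3 * t)" "y = cos (sqrt 3 * t)"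
  have x: "x > 0" using homogeneous_sin_pos assms by (simp add: xy)
  have s: "y\<^sup>2 = 1 - x\<^sup>2" by (simp add: xy cos_squared_eq)
  have "shape_one (homogeneous_u t) (homogeneous_v t) = - (2/3) * (1 - 2 * x\<^sup>2) + 2/3 * y\<^sup>2"
    unfolding shape_one_def homogeneous_components homogeneous_double_angle xy[symmetric]
    using x by (simp add: field_simps power2_eq_square)
  also have "\<dots> = 2/3 * x\<^sup>2" unfolding s by (simp add: right_diff_distrib)
  finally have e: "shape_one (homogeneous_u t) (homogeneous_v t) = 2/3 * x\<^sup>2" .
  show ?thesis unfolding e using x by simp
qed

section \<open>Positivity of w1 and w2\<close>

theorem proposition2p15:
  fixes lam :: "real \<Rightarrow> real \<Rightarrow> real"
    and u v w :: "real \<Rightarrow> real \<Rightarrow> real^3"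
    and R T :: "real \<Rightarrow> real"
    and b_star T_star :: real
  assumes Psi: "\<And>b. b > 0 \<Longrightarrow> is_Psi b (R b) (lam b) (u b) (v b)"
    and Psi_continuous:
      "continuous_on {(b, t). 0 < b \<and> 0 \<le> t \<and> t < R b} (\<lambda>(b, t). (lam b t, u b t, v b t))"
    and T: "\<And>b. b > 0 \<Longrightarrow> is_max_volume_time (R b) (lam b) (u b) (T b)"
    and w: "\<And>b t. w b t = nk_w (lam b t) (u b t) (v b t)"
    and b_star: "b_star \<in> {b. 0 < b \<and> b < 1 \<and> w b (T b) $ 1 = 0}"
    and b_star_last: "\<And>b. b \<in> {b. 0 < b \<and> b < 1 \<and> w b (T b) $ 1 = 0} \<Longrightarrow> b \<le> b_star"
    and T_star: "T_star = T b_star"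
  shows "(\<forall>t\<in>{0<..<T_star}. w b_star t $ 1 > 0) \<and> w b_star T_star $ 2 > 0"
proof -
  define f where "f b t = shape_one (u b t) (v b t)" for b t
  define g where "g b t = volume_speed (u b t) (v b t)" for b t
  have cl: "nk_closing_S3 b (R b) (lam b) (u b) (v b)" if "b > 0" for b
    using Psi[OF that] unfolding is_Psi_def by blast
  note st = nk_closing_values(2)[OF cl]
  have T_bounds: "0 < T b \<and> T b < R b" if "b > 0" for b
    using is_max_volume_time_iff[OF st T] that by blast
  have g_zero_iff: "g b t = 0 \<longleftrightarrow> t = T b" if "b > 0" "0 < t" "t < R b" for b t
    using is_max_volume_time_iff(3)[OF st T] that unfolding g_def by blast
  have w1_f: "w b t $ 1 > 0 \<longleftrightarrow> f b t > 0" "w b t $ 1 = 0 \<longleftrightarrow> f b t = 0"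
    and w2: "w b t $ 2 > 0 \<longleftrightarrow> shape_two (u b t) (v b t) > 0"
    if b: "b > 0" "0 < t" "t < R b" for b t
  proof -
    have m: "t \<in> {0<..<R b}" using b by simp
    show "w b t $ 1 > 0 \<longleftrightarrow> f b t > 0" "w b t $ 1 = 0 \<longleftrightarrow> f b t = 0"
      "w b t $ 2 > 0 \<longleftrightarrow> shape_two (u b t) (v b t) > 0"
      unfolding w f_def nk_w_components[OF st[OF b(1)] m]
      using nk_structureD(1,3)[OF st[OF b(1)] m] by (auto simp: zero_less_divide_iff mult_less_0_iff)
  qed
  let ?D = "{(b, t). 0 < b \<and> 0 < t \<and> t < R b}"
  have nz: "u (fst p) (snd p) $ 2 \<noteq> 0 \<and> v (fst p) (snd p) $ 1 \<noteq> 0" if "p \<in> ?D" for p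
    using nk_structureD(2,3)[OF st, of "fst p" "snd p"] that by (auto simp: case_prod_beta')
  have c: "continuous_on ?D (\<lambda>(b, t). (lam b t, u b t, v b t))"
    by (rule continuous_on_subset[OF Psi_continuous]) auto
  have cu: "continuous_on ?D (\<lambda>p. u (fst p) (snd p) $ i)" and cv: "continuous_on ?D (\<lambda>p. v (fst p) (snd p) $ i)" for i
    using continuous_on_component[OF continuous_on_fst[OF continuous_on_snd[OF c]]]
      continuous_on_component[OF continuous_on_snd[OF continuous_on_snd[OF c]]]
    by (simp_all add: case_prod_beta')
  have f_cont: "continuous_on ?D (\<lambda>(b, t). f b t)"
    unfolding f_def shape_one_def case_prod_beta'
    using nz by (intro continuous_on_diff continuous_on_divide continuous_on_mult cu[unfolded case_prod_beta']
      cv[unfolded case_prod_beta']) (auto simp: case_prod_beta')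
  have g_cont: "continuous_on ?D (\<lambda>(b, t). g b t)"
    unfolding g_def volume_speed_def case_prod_beta'
    using nz by (intro continuous_on_diff continuous_on_divide continuous_on_mult continuous_on_power
      continuous_on_const cu[unfolded case_prod_beta'] cv[unfolded case_prod_beta']) (auto simp: case_prod_beta')
  note start = family_near_start[OF cl Psi_continuous, folded f_def g_def]
  have f_start: "\<exists>e>0. \<forall>b t. \<bar>b - a\<bar> < e \<longrightarrow> 0 < b \<longrightarrow> 0 < t \<longrightarrow> t < e \<longrightarrow> t < R b \<longrightarrow> f b t > 0"
    and g_start: "\<exists>e>0. \<forall>b t. \<bar>b - a\<bar> < e \<longrightarrow> 0 < b \<longrightarrow> 0 < t \<longrightarrow> t < e \<longrightarrow> t < R b \<longrightarrow> g b t > 0"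
    if "0 < a" for a
    using start[OF _ that] by blast+
  have f_start': "\<exists>t. 0 < t \<and> t < e \<and> shape_one (u b t) (v b t) > 0" if be: "b > 0" "e > 0" for b e
  proof -
    obtain d where d: "d > 0" "\<And>t. 0 < t \<Longrightarrow> t < d \<Longrightarrow> t < R b \<Longrightarrow> f b t > 0"
      using f_start[OF be(1)] be by (metis abs_zero diff_self)
    obtain t where "0 < t" "t < min e (min d (R b))"
      using dense[of 0 "min e (min d (R b))"] d(1) be T_bounds[OF be(1)] by auto
    then show ?thesis using d(2)[of t] unfolding f_def by auto
  qed
  have g_sign: "0 < t \<Longrightarrow> t < T b \<Longrightarrow> g b t > 0" "T b < t \<Longrightarrow> t < R b \<Longrightarrow> g b t < 0" if b: "b > 0" for b t
  proof -
    note Tb = T_bounds[OF b]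
    have "T b \<in> {0<..<R b}" using Tb by simp
    then obtain D where D: "D < 0" "(g b has_real_derivative D) (at (T b))"
      using volume_speed_deriv_at_zero[OF st[OF b]] g_zero_iff[OF b] Tb unfolding g_def by metis
    have cont: "isCont (g b) t" if "0 < t" "t < R b" for t
    proof -
      have "continuous_on {0<..<R b} ((\<lambda>(b, t). g b t) \<circ> (\<lambda>t. (b, t)))"
        by (intro continuous_on_compose continuous_intros continuous_on_subset[OF g_cont]) (use b in auto)
      then have "continuous_on {0<..<R b} (g b)" by (simp add: o_def)
      then show ?thesis using that by (simp add: continuous_on_eq_continuous_at)
    qed
    obtain e where e: "e > 0" "\<And>c t. \<bar>c - b\<bar> < e \<Longrightarrow> 0 < c \<Longrightarrow> 0 < t \<Longrightarrow> t < e \<Longrightarrow> t < R c \<Longrightarrow> g c t > 0"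
      using g_start[OF b] by blast
    have start_b: "\<exists>e>0. \<forall>t. 0 < t \<longrightarrow> t < e \<longrightarrow> t < R b \<longrightarrow> g b t > 0"
      using e(1) e(2)[of b] b by auto
    note sign = sign_around_zero[OF cont conjunct1[OF Tb] conjunct2[OF Tb] g_zero_iff[OF b] start_b D]
    show "0 < t \<Longrightarrow> t < T b \<Longrightarrow> g b t > 0" by (rule sign(1))
    show "T b < t \<Longrightarrow> t < R b \<Longrightarrow> g b t < 0" by (rule sign(2))
  qed
  have f_nonneg: "f b t > 0" if b: "0 < b" and nonneg: "\<And>t. 0 < t \<Longrightarrow> t < T b \<Longrightarrow> f b t \<ge> 0" and t: "0 < t" "t < T b" for b t
    unfolding f_def
    by (rule shape_one_pos_if_nonneg[OF st[OF b] _ _ f_start'[OF b] t])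
      (use T_bounds[OF b] nonneg in \<open>auto simp: f_def\<close>)
  have hom: "u 1 t = homogeneous_u t" "v 1 t = homogeneous_v t" if "0 < t" "t < R 1" "t < pi / sqrt 3" for t
    using Psi[of 1] homogeneous_closing that unfolding is_Psi_def by fastforce+
  \<comment> \<open>The explicit solution is available only up to \<open>pi / sqrt 3\<close>. Its volume is critical at half that time, so \<open>T 1\<close> cannot lie beyond.\<close>
  have T1: "T 1 < pi / sqrt 3"
  proof (rule ccontr)
    assume n: "\<not> ?thesis"
    have half: "0 < x / 2 \<and> x / 2 < x" if "x > 0" for x :: real using that by simp
    have h: "0 < pi / sqrt 3 / 2" "pi / sqrt 3 / 2 < pi / sqrt 3"
      using half[of "pi / sqrt 3"] by simp_all
    then have r: "pi / sqrt 3 / 2 < R 1" using n T_bounds[of 1] by linarith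
    have "g 1 (pi / sqrt 3 / 2) = 0"
      unfolding g_def volume_speed_def hom[OF h(1) r h(2)] homogeneous_components by simp
    then show False using g_zero_iff[OF _ h(1) r] n h by simp
  qed
  have f1: "f 1 t > 0" if "0 < t" "t \<le> T 1" for t
  proof -
    have "t < R 1" "t < pi / sqrt 3" using that T1 T_bounds[of 1] by auto
    then show ?thesis unfolding f_def using hom[of t] homogeneous_shape_one_pos[of t] that(1) by simp
  qed
  have bs: "0 < b_star" "b_star < 1" "w b_star (T b_star) $ 1 = 0" using b_star by auto
  have f_end: "f b (T b) \<noteq> 0" if "b_star < b" "b \<le> 1" for b
  proof (cases "b = 1")
    case True
    then show ?thesis using f1[of "T 1"] T_bounds[of 1] by (simp add: less_imp_neq)
  next
    case False
    then show ?thesis using b_star_last[of b] that bs(1) w1_f(2)[of b "T b"] T_bounds[of b] by fastforce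
  qed
  have pos: "f b_star t > 0" if t: "0 < t" "t < T b_star" for t
  proof (rule positivity_propagates[where f = f and g = g and R = R and T = T and a = b_star and c = 1])
    show "g b (T b) = 0" if "0 < b" for b
      using g_zero_iff[OF that, of "T b"] T_bounds[OF that] by blast
    show "f 1 s > 0" if "0 < s" "s < T 1" for s by (rule f1[OF that(1) less_imp_le[OF that(2)]])
    show "0 < T b \<and> T b < R b" if "0 < b" for b by (rule T_bounds[OF that])
    show "f b s > 0" if "0 < b" "\<And>t. 0 < t \<Longrightarrow> t < T b \<Longrightarrow> 0 \<le> f b t" "0 < s" "s < T b" for b s
      by (rule f_nonneg[OF that])
  qed (fact f_cont g_cont f_start g_start g_sign bs f_end t)+
  have "shape_two (u b_star (T b_star)) (v b_star (T b_star)) > 0"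
  proof (rule shape_two_pos_at_first_zero[OF st[OF bs(1)] _ _ _ _ f_start'[OF bs(1)]])
    show "0 < T b_star" "T b_star < R b_star" using T_bounds[OF bs(1)] by auto
    show "shape_one (u b_star t) (v b_star t) \<ge> 0" if "0 < t" "t < T b_star" for t
      using pos[OF that] unfolding f_def by simp
    show "shape_one (u b_star (T b_star)) (v b_star (T b_star)) = 0"
      using w1_f(2)[OF bs(1)] bs(3) T_bounds[OF bs(1)] unfolding f_def by blast
  qed
  then show ?thesis
    unfolding T_star using pos w1_f(1)[OF bs(1)] w2[OF bs(1)] T_bounds[OF bs(1)] by auto
qed

end
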